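(* Let $\gamma$ be a space curve in the normal form described in the context, with Taylor coefficients $a_i$ $(i\ge 2)$, $b_i$ $(i\ge 3)$ and non-vanishing curvature at $0$. Let $\theta_1,\theta_2\in(0,\pi)$ with $\theta_1\neq\theta_2$, set $\varphi=\theta_1-\theta_2$, and let $\kappa_{\theta_1},\kappa_{\theta_2}$ be the curvatures of the two projected plane curves $\gamma_{\theta_1},\gamma_{\theta_2}$, regarded as functions of the arc-length parameters $s_1,s_2$ respectively. If $$\left(\frac{d\kappa_{\theta_1}}{ds_1}(0),\ \frac{d\kappa_{\theta_2}}{ds_2}(0)\right)\neq(0,0),$$ then the following hold. (1) $\theta_1$, $\theta_2$ and $b_3$ are uniquely determined from the second order information of $\kappa_{\theta_1},\kappa_{\theta_2}$ at $0$ and $\varphi=\theta_1-\theta_2$. (2) For every $n\ge 4$, the coefficients $a_{n-2}$ and $b_n$ are uniquely determined from the $(n-1)$-st order information of $\kappa_{\theta_1},\kappa_{\theta_2}$ at $0$ and $\varphi$.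
   Context: Curve: $I$ is an open interval containing $0$ and $\gamma:I\to\mathbb{R}^3$ is a regular $C^\infty$ curve with $\gamma(0)=(0,0,0)$ whose curvature does not vanish at $0$. After rotating coordinates of $\mathbb{R}^3$ and reparametrizing, for any $k\in\mathbb{N}$ it is written near $0$ as $$\gamma(t)=\Big(t,\ \sum_{i=2}^k\frac{a_i}{i!}t^i,\ \sum_{i=3}^k\frac{b_i}{i!}t^i\Big)+(O(k+1),O(k+1),O(k+1)),$$ where $a_i,b_i\in\mathbb{R}$ and $O(k+1)$ denotes terms of degree greater than $k$ (so $a_2\ne0$). When the coefficients $a_{n-2},b_n$ are considered, $k\ge n$ is taken. Projections: for a unit vector $\xi\in\mathbb{R}^3$, $\pi_\xi(x)=x-\langle x,\xi\rangle\xi:\mathbb{R}^3\to\xi^\perp$ is the orthogonal projection in the direction $\xi$. For $\theta\in(0,\pi)$ put $\xi(\theta)=(\cos\theta,\sin\theta,0)$ (a vector in the osculating plane of $\gamma$ at $0$, not tangent to $\gamma$) and $\gamma_\theta=\pi_{\xi(\theta)}\circ\gamma$. The plane $\xi^\perp$ is oriented so that a basis $\{X,Y\}$ of $\xi^\perp$ is positive iff $\{X,Y,\xi\}$ is a positive basis of $\mathbb{R}^3$, and $\gamma_\theta$ carries the orientation of $\gamma$. Then $s_j$ is the arc-length parameter of $\gamma_{\theta_j}$ ($s_j=0$ at $t=0$, increasing with $t$) and $\kappa_{\theta_j}$ is the signed curvature of $\gamma_{\theta_j}$ as a curve in the oriented plane $\xi(\theta_j)^\perp$; explicitly $\kappa_{\theta}=\det(\gamma',\gamma'',\xi(\theta))/|\gamma_{\theta}'|^3$.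 The $k$-th order information of a $C^\infty$ function $\psi$ of one variable at $0$ is $(\psi(0),\psi'(0),\psi''(0)/2,\ldots,\psi^{(k)}(0)/k!)$; for $\kappa_{\theta_j}$ derivatives are taken with respect to $s_j$. "A quantity is uniquely determined from given data" means: if two configurations $(\gamma,\theta_1,\theta_2)$ and $(\tilde\gamma,\tilde\theta_1,\tilde\theta_2)$ have the same data, then they have the same value of that quantity. Here each configuration consists of a regular $C^\infty$ curve through the origin at $t=0$ with non-vanishing curvature at $0$, written near $0$ as $\big(t,\ \sum_{i=2}^k\frac{a_i}{i!}t^i,\ \sum_{i=3}^k\frac{b_i}{i!}t^i\big)+(O(k+1),O(k+1),O(k+1))$ (with its own coefficients $a_i,b_i\in\mathbb{R}$, $a_2\neq0$), together with two distinct angles in $(0,\pi)$, such that the derivatives at $0$ of the curvatures of its two projected curves with respect to their arc-length parameters are not both zero. *)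

theory Defs
  imports "HOL-Analysis.Analysis" "HOL-Library.Landau_Symbols"
begin

subsection \<open>Regular smooth space curves in normal form\<close>

definition vderiv :: "nat \<Rightarrow> (real \<Rightarrow> 'a::real_normed_vector) \<Rightarrow> real \<Rightarrow> 'a" where
  "vderiv n c = ((\<lambda>g t. vector_derivative g (at t)) ^^ n) c"

definition regular_smooth_curve :: "real set \<Rightarrow> (real \<Rightarrow> real^3) \<Rightarrow> bool" where
  "regular_smooth_curve I \<gamma> \<longleftrightarrow>
     open I \<and> is_interval I \<and> 0 \<in> I \<and>
     (\<forall>n. \<forall>t\<in>I. vderiv n \<gamma> differentiable (at t)) \<and>
     (\<forall>t\<in>I. vderiv 1 \<gamma> t \<noteq> 0)"

definition space_curvature :: "(real \<Rightarrow> real^3) \<Rightarrow> real \<Rightarrow> real" where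
  "space_curvature \<gamma> t = norm (cross3 (vderiv 1 \<gamma> t) (vderiv 2 \<gamma> t)) / norm (vderiv 1 \<gamma> t) ^ 3"

text \<open>
  Only \<open>a i\<close> for \<open>2 \<le> i \<le> k\<close> and \<open>b i\<close> for \<open>3 \<le> i \<le> k\<close> are constrained; the other
  values of the sequences \<open>a\<close> and \<open>b\<close> are irrelevant.
\<close>

definition normal_form ::
    "nat \<Rightarrow> (real \<Rightarrow> real^3) \<Rightarrow> (nat \<Rightarrow> real) \<Rightarrow> (nat \<Rightarrow> real) \<Rightarrow> bool" where
  "normal_form k \<gamma> a b \<longleftrightarrow>
     (\<lambda>t. \<gamma> t $ 1 - t) \<in> O[at 0](\<lambda>t. t ^ (k + 1)) \<and>
     (\<lambda>t. \<gamma> t $ 2 - (\<Sum>i=2..k. a i / fact i * t ^ i)) \<in> O[at 0](\<lambda>t. t ^ (k + 1)) \<and>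
     (\<lambda>t. \<gamma> t $ 3 - (\<Sum>i=3..k. b i / fact i * t ^ i)) \<in> O[at 0](\<lambda>t. t ^ (k + 1))"


subsection \<open>Projected curves, their arc length and signed curvature\<close>

definition orth_proj :: "real^3 \<Rightarrow> real^3 \<Rightarrow> real^3" where
  "orth_proj \<xi> x = x - (x \<bullet> \<xi>) *\<^sub>R \<xi>"

definition xi :: "real \<Rightarrow> real^3" where
  "xi \<theta> = vector [cos \<theta>, sin \<theta>, 0]"

definition projected_curve :: "(real \<Rightarrow> real^3) \<Rightarrow> real \<Rightarrow> real \<Rightarrow> real^3" where
  "projected_curve \<gamma> \<theta> = orth_proj (xi \<theta>) \<circ> \<gamma>"

text \<open>
  Signed curvature of a curve \<open>c\<close> lying in the plane orthogonal to the unit vector \<open>\<xi>\<close>,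
  where a basis \<open>X, Y\<close> of this plane is positive iff \<open>X, Y, \<xi>\<close> is a positive basis
  of the space.
\<close>

definition plane_curvature :: "real^3 \<Rightarrow> (real \<Rightarrow> real^3) \<Rightarrow> real \<Rightarrow> real" where
  "plane_curvature \<xi> c t =
     det (vector [vderiv 1 c t, vderiv 2 c t, \<xi>] :: real^3^3) / norm (vderiv 1 c t) ^ 3"

lemma vderiv_projected_curve:
  assumes "regular_smooth_curve I \<gamma>" "t \<in> I"
  shows "vderiv n (projected_curve \<gamma> \<theta>) t = orth_proj (xi \<theta>) (vderiv n \<gamma> t)"
  using assms(2)
proof (induction n arbitrary: t)
  case 0
  then show ?case by (simp add: vderiv_def projected_curve_def)
next
  case (Suc n)
  have "open I" and diff: "vderiv n \<gamma> differentiable (at t)"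
    using assms(1) Suc.prems by (auto simp: regular_smooth_curve_def)
  have lin: "bounded_linear (orth_proj (xi \<theta>))"
    unfolding orth_proj_def [abs_def]
    by (intro bounded_linear_sub bounded_linear_ident bounded_linear_scaleR_const
        bounded_linear_inner_left)
  have "(vderiv n \<gamma> has_vector_derivative vderiv (Suc n) \<gamma> t) (at t)"
    using diff by (simp add: vderiv_def vector_derivative_works)
  then have "((\<lambda>u. orth_proj (xi \<theta>) (vderiv n \<gamma> u)) has_vector_derivative
      orth_proj (xi \<theta>) (vderiv (Suc n) \<gamma> t)) (at t)"
    by (rule bounded_linear.has_vector_derivative [OF lin])
  then have "(vderiv n (projected_curve \<gamma> \<theta>) has_vector_derivative
      orth_proj (xi \<theta>) (vderiv (Suc n) \<gamma> t)) (at t)"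
    by (rule has_vector_derivative_transform_within_open [OF _ \<open>open I\<close> Suc.prems])
       (simp add: Suc.IH)
  then show ?case
    by (simp add: vderiv_def vector_derivative_at)
qed

lemma plane_curvature_projected_curve:
  assumes "regular_smooth_curve I \<gamma>" "t \<in> I"
  shows "plane_curvature (xi \<theta>) (projected_curve \<gamma> \<theta>) t =
    det (vector [vderiv 1 \<gamma> t, vderiv 2 \<gamma> t, xi \<theta>] :: real^3^3) /
      norm (vderiv 1 (projected_curve \<gamma> \<theta>) t) ^ 3"
proof -
  have "det (vector [orth_proj z x, orth_proj z y, z] :: real^3^3) = det (vector [x, y, z] :: real^3^3)"
    for x y z
    by (simp add: det_3 orth_proj_def vector_3 algebra_simps)
  then show ?thesis
    unfolding plane_curvature_def vderiv_projected_curve [OF assms] by simp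
qed

text \<open>The interval integral is oriented, so the arc length is negative for \<open>t < 0\<close>.\<close>

definition arc_length :: "(real \<Rightarrow> real^3) \<Rightarrow> real \<Rightarrow> real" where
  "arc_length c t = (LBINT u=0..t. norm (vderiv 1 c u))"

text \<open>
  A projection of a regular curve may have singular points away from \<open>0\<close>.  The arc length is
  therefore inverted on the largest interval around \<open>0\<close> on which the projected curve is regular;
  there it is strictly increasing.
\<close>

definition regular_part :: "real set \<Rightarrow> (real \<Rightarrow> real^3) \<Rightarrow> real set" where
  "regular_part I c = connected_component_set {t\<in>I. vderiv 1 c t \<noteq> 0} 0"

definition curvature_of_arc_length ::
    "real set \<Rightarrow> (real \<Rightarrow> real^3) \<Rightarrow> real \<Rightarrow> real \<Rightarrow> real" where
  "curvature_of_arc_length I \<gamma> \<theta> s =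
     (let c = projected_curve \<gamma> \<theta>
      in plane_curvature (xi \<theta>) c (inv_into (regular_part I c) (arc_length c) s))"

definition order_info :: "nat \<Rightarrow> (real \<Rightarrow> real) \<Rightarrow> real list" where
  "order_info k \<psi> = map (\<lambda>i. (deriv ^^ i) \<psi> 0 / fact i) [0..<Suc k]"


subsection \<open>Configurations\<close>

record configuration =
  dom_of :: "real set"
  curve :: "real \<Rightarrow> real^3"
  coeff_a :: "nat \<Rightarrow> real"
  coeff_b :: "nat \<Rightarrow> real"
  theta1 :: real
  theta2 :: real

definition kappa1 :: "configuration \<Rightarrow> real \<Rightarrow> real" where
  "kappa1 C = curvature_of_arc_length (dom_of C) (curve C) (theta1 C)"

definition kappa2 :: "configuration \<Rightarrow> real \<Rightarrow> real" where
  "kappa2 C = curvature_of_arc_length (dom_of C) (curve C) (theta2 C)"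

definition configurations :: "nat \<Rightarrow> configuration set" where
  "configurations k = {C.
     regular_smooth_curve (dom_of C) (curve C) \<and>
     curve C 0 = 0 \<and>
     space_curvature (curve C) 0 \<noteq> 0 \<and>
     normal_form k (curve C) (coeff_a C) (coeff_b C) \<and>
     theta1 C \<in> {0<..<pi} \<and> theta2 C \<in> {0<..<pi} \<and> theta1 C \<noteq> theta2 C \<and>
     (deriv (kappa1 C) 0, deriv (kappa2 C) 0) \<noteq> (0, 0)}"

definition uniquely_determined :: "'c set \<Rightarrow> ('c \<Rightarrow> 'q) \<Rightarrow> ('c \<Rightarrow> 'd) \<Rightarrow> bool" where
  "uniquely_determined S quantity data \<longleftrightarrow>
     (\<forall>C\<in>S. \<forall>C'\<in>S. data C = data C' \<longrightarrow> quantity C = quantity C')"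

definition curvature_data :: "nat \<Rightarrow> configuration \<Rightarrow> real list \<times> real list \<times> real" where
  "curvature_data m C =
     (order_info m (kappa1 C), order_info m (kappa2 C), theta1 C - theta2 C)"

end

theory Submission
  imports Defs
begin

text \<open>
  In the plane orthogonal to \<open>\<xi>(\<theta>) = (cos \<theta>, sin \<theta>, 0)\<close> the vectors \<open>(sin \<theta>, - cos \<theta>, 0)\<close>
  and \<open>(0, 0, -1)\<close> form a positive orthonormal basis, and in these coordinates the projection of
  \<open>\<gamma> = (x, y, z)\<close> is the plane curve \<open>(u, v) = (x sin \<theta> - y cos \<theta>, - z)\<close>.  It starts at the
  origin in the direction of the first axis.  Parametrized by arc length \<open>s\<close> it becomes \<open>(U, V)\<close>
  with \<open>U' = P\<close>, \<open>V' = Q\<close>, \<open>P' = - \<kappa> Q\<close>, \<open>Q' = \<kappa> P\<close>, so the jet of \<open>\<kappa>\<close> at \<open>0\<close> fixes the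
  jets of \<open>U\<close> and \<open>V\<close>.  What it does not fix is the parameter \<open>t\<close> of the space curve, and this is
  where two projections are needed.

  Angles.  Since \<open>V = \<kappa>'(0) s^3/6 + \<dots>\<close>, \<open>v = - b\<^sub>3 t^3/6 + \<dots>\<close> and \<open>s = t sin \<theta> + \<dots>\<close>, one has
  \<open>\<kappa>'(0) = - b\<^sub>3 / sin\<^sup>3 \<theta>\<close> (\<open>projected_frame_in_normal_form\<close>).  The hypothesis of the theorem
  therefore says \<open>b\<^sub>3 \<noteq> 0\<close>, the quotient of the two derivatives gives \<open>sin \<theta>\<^sub>1 / sin \<theta>\<^sub>2\<close>, and for a
  known difference \<open>\<phi> \<noteq> 0\<close> this quotient \<open>cos \<phi> + sin \<phi> cot \<theta>\<^sub>2\<close> determines \<open>\<theta>\<^sub>2\<close>.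

  Coefficients.  Compare two configurations with the same data whose coefficients agree below
  \<open>a\<^sub>m\<close> and \<open>b\<^sub>n\<close>, where \<open>n = m + 2\<close>.  Write \<open>A t^m\<close> and \<open>B t^n\<close> for the leading terms of the
  differences of \<open>y\<close> and of \<open>z\<close>.  The difference \<open>- A cos \<theta> t^m\<close> of the \<open>u\<close> coordinates must come
  from a difference of the arc lengths, because \<open>U\<close> is the same up to higher order and has slope
  \<open>1\<close>.  As \<open>Q\<close> is about \<open>\<kappa>'(0) s^2/2\<close>, that shift of arc length changes \<open>v\<close> by
  \<open>- A cos \<theta> \<kappa>'(0) sin\<^sup>2 \<theta> t^n / 2\<close>, which has to equal \<open>- B t^n\<close>.  Hence
  \<open>2 B sin \<theta> = - b\<^sub>3 A cos \<theta>\<close> (\<open>projected_coefficient_constraint\<close>).  For two angles with different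
  cotangents this forces \<open>A = B = 0\<close>, and induction on \<open>n\<close> finishes the proof.

  All asymptotic statements are limits of quotients \<open>f t / t^m\<close> at \<open>0\<close>; higher derivatives enter only
  to turn the equality of the jets of two curvatures into such a limit, and for that one has to know
  that curvature is smooth as a function of arc length.
\<close>

section \<open>Finite order differentiability on open sets of reals\<close>

text \<open>
  Existence of derivatives is all that is recorded, without continuity of the last one: this makes the
  closure properties one-line inductions, and for functions with derivatives of all orders nothing
  is lost.
\<close>

primrec ndiff :: "nat \<Rightarrow> real set \<Rightarrow> (real \<Rightarrow> real) \<Rightarrow> bool" where
  "ndiff 0 S f \<longleftrightarrow> True"
| "ndiff (Suc n) S f \<longleftrightarrow>
     (\<exists>f'. (\<forall>x\<in>S. (f has_real_derivative f' x) (at x)) \<and> ndiff n S f')"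

declare ndiff.simps(2) [simp del]

lemma ndiff_SucI:
  assumes "\<And>x. x \<in> S \<Longrightarrow> (f has_real_derivative f' x) (at x)" "ndiff n S f'"
  shows "ndiff (Suc n) S f"
  unfolding ndiff.simps using assms by (intro exI [of _ f'] conjI ballI)

lemma ndiff_SucE:
  assumes "ndiff (Suc n) S f"
  obtains f' where "\<forall>x\<in>S. (f has_real_derivative f' x) (at x)" "ndiff n S f'"
  using assms unfolding ndiff.simps by (elim exE conjE)

lemma ndiff_SucD: "ndiff (Suc n) S f \<Longrightarrow> ndiff n S f"
proof (induction n arbitrary: f)
  case (Suc n)
  from Suc.prems obtain f' where f':
    "\<forall>x\<in>S. (f has_real_derivative f' x) (at x)" "ndiff (Suc n) S f'"
    by (rule ndiff_SucE)
  show ?case by (rule ndiff_SucI [OF bspec [OF f'(1)] Suc.IH [OF f'(2)]])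
qed simp

lemma ndiff_cong:
  assumes "open S" "\<And>x. x \<in> S \<Longrightarrow> f x = g x" "ndiff n S f"
  shows "ndiff n S g"
proof (cases n)
  case (Suc m)
  with assms(3) obtain f' where f':
    "\<forall>x\<in>S. (f has_real_derivative f' x) (at x)" "ndiff m S f'"
    by (simp only:) (erule ndiff_SucE)
  have "(g has_real_derivative f' x) (at x)" if "x \<in> S" for x
    by (rule has_field_derivative_transform_within_open
          [OF bspec [OF f'(1) that] assms(1) that assms(2)])
  from ndiff_SucI [OF this f'(2)] Suc show ?thesis by simp
qed simp

lemma ndiff_const: "ndiff n S (\<lambda>x. c)"
proof (induction n arbitrary: c)
  case (Suc n)
  show ?case by (rule ndiff_SucI [OF _ Suc.IH [of 0]]) simp
qed simp

lemma ndiff_sequence: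
  assumes "\<And>n x. x \<in> S \<Longrightarrow> (F n has_real_derivative F (Suc n) x) (at x)"
  shows "ndiff m S (F n)"
proof (induction m arbitrary: n)
  case (Suc m)
  show ?case by (rule ndiff_SucI [OF assms Suc.IH])
qed simp

lemma ndiff_add: "ndiff n S f \<Longrightarrow> ndiff n S g \<Longrightarrow> ndiff n S (\<lambda>x. f x + g x)"
proof (induction n arbitrary: f g)
  case (Suc n)
  from Suc.prems(1) obtain f' where f':
    "\<forall>x\<in>S. (f has_real_derivative f' x) (at x)" "ndiff n S f'"
    by (rule ndiff_SucE)
  from Suc.prems(2) obtain g' where g':
    "\<forall>x\<in>S. (g has_real_derivative g' x) (at x)" "ndiff n S g'"
    by (rule ndiff_SucE)
  show ?case
    by (rule ndiff_SucI [OF DERIV_add [OF bspec [OF f'(1)] bspec [OF g'(1)]] Suc.IH [OF f'(2) g'(2)]])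
qed simp

lemma ndiff_mult: "ndiff n S f \<Longrightarrow> ndiff n S g \<Longrightarrow> ndiff n S (\<lambda>x. f x * g x)"
proof (induction n arbitrary: f g)
  case (Suc n)
  from Suc.prems(1) obtain f' where f':
    "\<forall>x\<in>S. (f has_real_derivative f' x) (at x)" "ndiff n S f'"
    by (rule ndiff_SucE)
  from Suc.prems(2) obtain g' where g':
    "\<forall>x\<in>S. (g has_real_derivative g' x) (at x)" "ndiff n S g'"
    by (rule ndiff_SucE)
  have "ndiff n S (\<lambda>x. f' x * g x + g' x * f x)"
    by (intro ndiff_add Suc.IH f'(2) g'(2) ndiff_SucD [OF Suc.prems(1)] ndiff_SucD [OF Suc.prems(2)])
  moreover have "((\<lambda>x. f x * g x) has_real_derivative f' x * g x + g' x * f x) (at x)" if "x \<in> S" for x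
    using DERIV_mult [OF bspec [OF f'(1) that] bspec [OF g'(1) that]] .
  ultimately show ?case by (intro ndiff_SucI [where f' = "\<lambda>x. f' x * g x + g' x * f x"])
qed simp

lemma ndiff_diff:
  assumes "ndiff n S f" "ndiff n S g"
  shows "ndiff n S (\<lambda>x. f x - g x)"
  using ndiff_add [OF assms(1) ndiff_mult [OF ndiff_const [of n S "-1"] assms(2)]] by simp

text \<open>
  The derivative of a real power is again a real power, up to a constant.  This one lemma covers the
  square roots and reciprocals that occur in speed and curvature.
\<close>

lemma ndiff_powr: "ndiff n {0<..} (\<lambda>x. x powr a)"
proof (induction n arbitrary: a)
  case (Suc n)
  have "((\<lambda>x. x powr a) has_real_derivative a * x powr (a - 1)) (at x)" if "x \<in> {0<..}" for x
    using that has_real_derivative_powr by simp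
  then show ?case
    by (rule ndiff_SucI [OF _ ndiff_mult [OF ndiff_const Suc.IH]])
qed simp

lemma ndiff_compose:
  "ndiff n S f \<Longrightarrow> ndiff n T g \<Longrightarrow> f ` S \<subseteq> T \<Longrightarrow> ndiff n S (\<lambda>x. g (f x))"
proof (induction n arbitrary: g)
  case (Suc n)
  from Suc.prems(1) obtain f' where f':
    "\<forall>x\<in>S. (f has_real_derivative f' x) (at x)" "ndiff n S f'"
    by (rule ndiff_SucE)
  from Suc.prems(2) obtain g' where g':
    "\<forall>x\<in>T. (g has_real_derivative g' x) (at x)" "ndiff n T g'"
    by (rule ndiff_SucE)
  have "ndiff n S (\<lambda>x. g' (f x) * f' x)"
    using f'(2) Suc.IH [OF ndiff_SucD [OF Suc.prems(1)] g'(2) Suc.prems(3)]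
    by (intro ndiff_mult)
  moreover have "((\<lambda>x. g (f x)) has_real_derivative g' (f x) * f' x) (at x)" if "x \<in> S" for x
    using that Suc.prems(3) by (intro DERIV_chain2 [OF bspec [OF g'(1)] bspec [OF f'(1)]]) auto
  ultimately show ?case by (intro ndiff_SucI [where f' = "\<lambda>x. g' (f x) * f' x"])
qed simp

text \<open>
  The inverse of arc length satisfies \<open>T' = h \<circ> T\<close> with \<open>h\<close> the reciprocal of the speed, so each order
  of differentiability of \<open>T\<close> yields the next one.
\<close>

lemma ndiff_autonomous_solution:
  assumes "\<And>s. s \<in> S \<Longrightarrow> (T has_real_derivative h (T s)) (at s)"
    and "T ` S \<subseteq> J" and "\<And>n. ndiff n J h"
  shows "ndiff n S T"
proof (induction n)
  case (Suc n)
  show ?case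
    by (rule ndiff_SucI [OF assms(1) ndiff_compose [OF Suc.IH assms(3,2)]])
qed simp

lemma ndiff_funpow_deriv:
  assumes "open S" "ndiff (Suc n) S f" "x \<in> S"
  shows "((deriv ^^ n) f has_real_derivative (deriv ^^ Suc n) f x) (at x)"
  using assms(2)
proof (induction n arbitrary: f)
  case 0
  then obtain f' where "(f has_real_derivative f' x) (at x)"
    using assms(3) by (blast elim: ndiff_SucE)
  then show ?case by (simp add: DERIV_imp_deriv)
next
  case (Suc n)
  from Suc.prems obtain f' where f':
    "\<forall>x\<in>S. (f has_real_derivative f' x) (at x)" "ndiff (Suc n) S f'"
    by (rule ndiff_SucE)
  have "ndiff (Suc n) S (deriv f)"
    by (rule ndiff_cong [OF assms(1) _ f'(2)]) (simp add: DERIV_imp_deriv [OF bspec [OF f'(1)]])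
  from Suc.IH [OF this] show ?case unfolding funpow_Suc_right o_apply .
qed

section \<open>Asymptotic comparison at the origin\<close>

lemma tendsto_div_power_lower:
  fixes f :: "real \<Rightarrow> real"
  assumes "((\<lambda>t. f t / t ^ m) \<longlongrightarrow> l) (at 0)" "j < m"
  shows "((\<lambda>t. f t / t ^ j) \<longlongrightarrow> 0) (at 0)"
proof -
  have "((\<lambda>t. f t / t ^ m * t ^ (m - j)) \<longlongrightarrow> l * 0 ^ (m - j)) (at 0)"
    by (intro tendsto_intros assms)
  moreover have "\<forall>\<^sub>F t in at (0::real). f t / t ^ m * t ^ (m - j) = f t / t ^ j"
    using assms(2) by (auto simp: eventually_at_filter power_diff)
  ultimately show ?thesis
    using assms(2) by (simp add: tendsto_cong power_0_left)
qed

text \<open>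
  L'Hospital's rule against \<open>s^(j+1)\<close>: leading terms may be integrated.
\<close>

lemma tendsto_div_power_integrate:
  fixes f f' :: "real \<Rightarrow> real"
  assumes "\<forall>\<^sub>F s in nhds 0. (f has_real_derivative f' s) (at s)" "f 0 = 0"
    and "((\<lambda>s. f' s / s ^ j) \<longlongrightarrow> c) (at 0)"
  shows "((\<lambda>s. f s / s ^ Suc j) \<longlongrightarrow> c / (real j + 1)) (at 0)"
proof (rule lhopital)
  have "isCont f 0"
    using assms(1) DERIV_isCont eventually_nhds_x_imp_x by fastforce
  then show "(f \<longlongrightarrow> 0) (at 0)"
    using assms(2) by (simp add: isCont_def)
  show "((\<lambda>s. s ^ Suc j) \<longlongrightarrow> 0) (at (0::real))"
    by (rule tendsto_eq_intros | simp)+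
  show "\<forall>\<^sub>F s in at (0::real). s ^ Suc j \<noteq> 0"
    "\<forall>\<^sub>F s in at (0::real). real (Suc j) * s ^ j \<noteq> 0"
    using eventually_neq_at_within [of 0 0 UNIV] by (eventually_elim, simp)+
  show "\<forall>\<^sub>F s in at 0. (f has_real_derivative f' s) (at s)"
    using assms(1) by (auto simp: eventually_at_filter elim: eventually_mono)
  show "\<forall>\<^sub>F s in at (0::real). ((\<lambda>s. s ^ Suc j) has_real_derivative real (Suc j) * s ^ j) (at s)"
    by (rule always_eventually) (use DERIV_pow [of "Suc j"] in simp)
  have "((\<lambda>s. f' s / s ^ j / (real j + 1)) \<longlongrightarrow> c / (real j + 1)) (at 0)"
    by (intro tendsto_intros assms) auto
  then show "((\<lambda>s. f' s / (real (Suc j) * s ^ j)) \<longlongrightarrow> c / (real j + 1)) (at 0)"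
    by (simp add: mult.commute add.commute)
qed

text \<open>
  Taylor's theorem for a function with vanishing jet, obtained by integrating from \<open>H N\<close> down to
  \<open>H 0\<close>.
\<close>

lemma tendsto_div_power_of_vanishing_derivatives:
  fixes H :: "nat \<Rightarrow> real \<Rightarrow> real"
  assumes "\<And>i. \<forall>\<^sub>F s in nhds 0. (H i has_real_derivative H (Suc i) s) (at s)"
    and "\<And>i. i \<le> N \<Longrightarrow> H i 0 = 0"
  shows "((\<lambda>s. H 0 s / s ^ N) \<longlongrightarrow> 0) (at 0)"
proof -
  \<comment> \<open>Each integration trades one derivative for one power of \<open>s\<close>.\<close>
  have "((\<lambda>s. H (N - j) s / s ^ j) \<longlongrightarrow> 0) (at 0)" if "j \<le> N" for j
    using that
  proof (induction j)
    case 0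
    have "isCont (H N) 0"
      using assms(1) [of N] DERIV_isCont eventually_nhds_x_imp_x by fastforce
    then show ?case using assms(2) [of N] by (simp add: isCont_def)
  next
    case (Suc j)
    then have "Suc (N - Suc j) = N - j" by simp
    then show ?case
      using tendsto_div_power_integrate [OF assms(1) [of "N - Suc j"] assms(2), of j 0] Suc by simp
  qed
  from this [of N] show ?thesis by simp
qed

lemma polynomial_difference_limit:
  fixes f g :: "real \<Rightarrow> real"
  assumes f: "(\<lambda>t. f t - (\<Sum>i=j..k. p i * t ^ i)) \<in> O[at 0](\<lambda>t. t ^ (k + 1))"
    and g: "(\<lambda>t. g t - (\<Sum>i=j..k. q i * t ^ i)) \<in> O[at 0](\<lambda>t. t ^ (k + 1))"
    and m: "j \<le> m" "m \<le> k" and eq: "\<And>i. j \<le> i \<Longrightarrow> i < m \<Longrightarrow> p i = q i"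
  shows "((\<lambda>t. (f t - g t) / t ^ m) \<longlongrightarrow> p m - q m) (at 0)"
proof -
  let ?E = "\<lambda>t. (f t - (\<Sum>i=j..k. p i * t ^ i)) - (g t - (\<Sum>i=j..k. q i * t ^ i))"
  have "?E \<in> O[at 0](\<lambda>t. t ^ (k + 1))"
    using f g by (rule sum_in_bigo)
  also have "(\<lambda>t::real. t ^ (k + 1)) \<in> o[at 0](\<lambda>t. t ^ m)"
  proof (rule smalloI_tendsto)
    have "((\<lambda>t::real. t ^ (k + 1 - m)) \<longlongrightarrow> 0 ^ (k + 1 - m)) (at 0)"
      by (intro tendsto_intros)
    moreover have "\<forall>\<^sub>F t in at (0::real). t ^ (k + 1 - m) = t ^ (k + 1) / t ^ m"
      using m by (auto simp: eventually_at_filter power_diff)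
    ultimately show "((\<lambda>t::real. t ^ (k + 1) / t ^ m) \<longlongrightarrow> 0) (at 0)"
      using m by (subst (asm) tendsto_cong) (auto simp: power_0_left)
    show "\<forall>\<^sub>F t in at (0::real). t ^ m \<noteq> 0"
      using eventually_neq_at_within [of 0 0 UNIV] by eventually_elim simp
  qed
  finally have E: "((\<lambda>t. ?E t / t ^ m) \<longlongrightarrow> 0) (at 0)"
    by (rule smalloD_tendsto)
  have S: "((\<lambda>t. \<Sum>i=j..k. (p i - q i) * (t ^ i / t ^ m)) \<longlongrightarrow>
      (\<Sum>i=j..k. if i = m then p m - q m else 0)) (at 0)"
  proof (rule tendsto_sum)
    fix i assume i: "i \<in> {j..k}"
    consider "i < m" | "i = m" | "m < i" by linarith
    then show "((\<lambda>t::real. (p i - q i) * (t ^ i / t ^ m)) \<longlongrightarrow>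
        (if i = m then p m - q m else 0)) (at 0)"
    proof cases
      case 1
      then show ?thesis using eq i by simp
    next
      case 2
      have "\<forall>\<^sub>F t::real in at 0. (p i - q i) * (t ^ i / t ^ m) = p m - q m"
        using eventually_neq_at_within [of 0 0 UNIV] by eventually_elim (simp add: 2)
      with 2 show ?thesis by (auto intro: tendsto_eventually)
    next
      case 3
      have "((\<lambda>t::real. (p i - q i) * t ^ (i - m)) \<longlongrightarrow> (p i - q i) * 0 ^ (i - m)) (at 0)"
        by (intro tendsto_intros)
      moreover have "\<forall>\<^sub>F t::real in at 0. (p i - q i) * t ^ (i - m) = (p i - q i) * (t ^ i / t ^ m)"
        using 3 by (auto simp: eventually_at_filter power_diff)
      ultimately show ?thesis using 3 by (simp add: tendsto_cong power_0_left)
    qed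
  qed
  have "(f t - g t) / t ^ m = ?E t / t ^ m + (\<Sum>i=j..k. (p i - q i) * (t ^ i / t ^ m))" for t
  proof -
    have "(\<Sum>i=j..k. (p i - q i) * (t ^ i / t ^ m)) =
        ((\<Sum>i=j..k. p i * t ^ i) - (\<Sum>i=j..k. q i * t ^ i)) / t ^ m"
      unfolding sum_subtractf [symmetric] sum_divide_distrib
      by (rule sum.cong) (auto simp: left_diff_distrib)
    then show ?thesis by (simp only: add_divide_distrib [symmetric]) simp
  qed
  then show ?thesis
    using tendsto_add [OF E S] m by simp
qed

lemma tendsto_div_power_compose:
  fixes F \<sigma> :: "real \<Rightarrow> real"
  assumes F: "((\<lambda>s. F s / s ^ p) \<longlongrightarrow> L) (at 0)"
    and \<sigma>: "((\<lambda>t. \<sigma> t / t) \<longlongrightarrow> r) (at 0)" and r: "r \<noteq> 0"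
  shows "((\<lambda>t. F (\<sigma> t) / t ^ p) \<longlongrightarrow> L * r ^ p) (at 0)"
proof -
  have \<sigma>0: "(\<sigma> \<longlongrightarrow> 0) (at 0)"
    using tendsto_div_power_lower [of \<sigma> 1 r 0] \<sigma> by simp
  have "\<forall>\<^sub>F t in at 0. \<sigma> t / t \<noteq> 0"
    using \<sigma> r by (rule tendsto_imp_eventually_ne)
  then have ne: "\<forall>\<^sub>F t in at 0. \<sigma> t \<noteq> 0" by eventually_elim auto
  have "filterlim \<sigma> (at 0) (at 0)"
    using \<sigma>0 ne by (simp add: filterlim_at)
  then have "((\<lambda>t. F (\<sigma> t) / \<sigma> t ^ p) \<longlongrightarrow> L) (at 0)"
    by (rule filterlim_compose [OF F])
  then have "((\<lambda>t. F (\<sigma> t) / \<sigma> t ^ p * (\<sigma> t / t) ^ p) \<longlongrightarrow> L * r ^ p) (at 0)"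
    by (intro tendsto_intros \<sigma>)
  moreover have "\<forall>\<^sub>F t in at 0. F (\<sigma> t) / \<sigma> t ^ p * (\<sigma> t / t) ^ p = F (\<sigma> t) / t ^ p"
    using ne by eventually_elim (simp add: power_divide)
  ultimately show ?thesis
    by (simp add: tendsto_cong)
qed

text \<open>
  By the mean value theorem an increment of \<open>F\<close> is a value of \<open>F'\<close> times the increment of the
  argument.  The intermediate point lies between \<open>\<sigma> t\<close> and \<open>\<tau> t\<close>, hence is itself asymptotic to
  \<open>r t\<close>, and the factor inherits the leading term of \<open>F'\<close>.
\<close>

lemma increment_asymptotics:
  fixes F F' \<sigma> \<tau> :: "real \<Rightarrow> real"
  assumes F: "\<forall>\<^sub>F s in nhds 0. (F has_real_derivative F' s) (at s)"
    and F': "((\<lambda>s. F' s / s ^ p) \<longlongrightarrow> L) (at 0)"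
    and \<sigma>: "((\<lambda>t. \<sigma> t / t) \<longlongrightarrow> r) (at 0)" and \<tau>: "((\<lambda>t. \<tau> t / t) \<longlongrightarrow> r) (at 0)"
    and r: "r \<noteq> 0"
  obtains q where "\<forall>\<^sub>F t in at 0. F (\<sigma> t) - F (\<tau> t) = q t * (\<sigma> t - \<tau> t)"
    and "((\<lambda>t. q t / t ^ p) \<longlongrightarrow> L * r ^ p) (at 0)"
proof -
  obtain d where d: "d > 0" "\<And>s. \<bar>s\<bar> < d \<Longrightarrow> (F has_real_derivative F' s) (at s)"
    using F by (auto simp: eventually_nhds_metric dist_real_def)
  have mid: "\<exists>c. min x y \<le> c \<and> c \<le> max x y \<and> F x - F y = F' c * (x - y)"
    if bd: "\<bar>x\<bar> < d" "\<bar>y\<bar> < d" for x y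
  proof -
    have *: "\<exists>c. x \<le> c \<and> c \<le> y \<and> F y - F x = F' c * (y - x)"
      if xy: "x < y" "\<bar>x\<bar> < d" "\<bar>y\<bar> < d" for x y
    proof -
      have "\<exists>z. x < z \<and> z < y \<and> F y - F x = (y - x) * F' z"
        using xy by (intro MVT2) (auto intro!: d(2))
      then show ?thesis by (metis less_imp_le mult.commute)
    qed
    consider "x < y" | "x = y" | "y < x" by linarith
    then show ?thesis
    proof cases
      case 1
      obtain c where "x \<le> c" "c \<le> y" "F y - F x = F' c * (y - x)"
        using * [OF 1 bd] by (elim exE conjE)
      then show ?thesis using 1 by (intro exI [of _ c]) (simp add: algebra_simps)
    next
      case 2
      then show ?thesis by (intro exI [of _ x]) simp
    next
      case 3
      obtain c where "y \<le> c" "c \<le> x" "F x - F y = F' c * (x - y)"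
        using * [OF 3 bd(2,1)] by (elim exE conjE)
      then show ?thesis using 3 by (intro exI [of _ c]) simp
    qed
  qed
  have "\<exists>c. \<forall>t. \<bar>\<sigma> t\<bar> < d \<and> \<bar>\<tau> t\<bar> < d \<longrightarrow> min (\<sigma> t) (\<tau> t) \<le> c t \<and> c t \<le> max (\<sigma> t) (\<tau> t)
      \<and> F (\<sigma> t) - F (\<tau> t) = F' (c t) * (\<sigma> t - \<tau> t)"
  proof (intro choice allI)
    fix t
    show "\<exists>c. \<bar>\<sigma> t\<bar> < d \<and> \<bar>\<tau> t\<bar> < d \<longrightarrow> min (\<sigma> t) (\<tau> t) \<le> c \<and> c \<le> max (\<sigma> t) (\<tau> t)
      \<and> F (\<sigma> t) - F (\<tau> t) = F' c * (\<sigma> t - \<tau> t)"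
      using mid [of "\<sigma> t" "\<tau> t"] by (cases "\<bar>\<sigma> t\<bar> < d \<and> \<bar>\<tau> t\<bar> < d") (auto simp only: simp_thms)
  qed
  then obtain c where c: "\<forall>t. \<bar>\<sigma> t\<bar> < d \<and> \<bar>\<tau> t\<bar> < d \<longrightarrow> min (\<sigma> t) (\<tau> t) \<le> c t \<and> c t \<le> max (\<sigma> t) (\<tau> t)
      \<and> F (\<sigma> t) - F (\<tau> t) = F' (c t) * (\<sigma> t - \<tau> t)"
    by (elim exE)
  have small: "\<forall>\<^sub>F t in at 0. \<bar>\<rho> t\<bar> < d" if "((\<lambda>t. \<rho> t / t) \<longlongrightarrow> r) (at 0)" for \<rho> :: "real \<Rightarrow> real"
  proof -
    have "((\<lambda>t. \<rho> t / t ^ 0) \<longlongrightarrow> 0) (at 0)"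
      by (rule tendsto_div_power_lower [of _ 1 r]) (use that in auto)
    then have "((\<lambda>t. \<bar>\<rho> t\<bar>) \<longlongrightarrow> 0) (at 0)" by (simp add: tendsto_rabs_zero)
    then show ?thesis using d(1) by (rule order_tendstoD)
  qed
  have ev: "\<forall>\<^sub>F t in at 0. min (\<sigma> t) (\<tau> t) \<le> c t \<and> c t \<le> max (\<sigma> t) (\<tau> t)
      \<and> F (\<sigma> t) - F (\<tau> t) = F' (c t) * (\<sigma> t - \<tau> t)"
    using small [OF \<sigma>] small [OF \<tau>] by eventually_elim (use c in simp)
  have cr: "((\<lambda>t. c t / t) \<longlongrightarrow> r) (at 0)"
  proof (rule tendsto_sandwich)
    show "((\<lambda>t. min (\<sigma> t / t) (\<tau> t / t)) \<longlongrightarrow> r) (at 0)" "((\<lambda>t. max (\<sigma> t / t) (\<tau> t / t)) \<longlongrightarrow> r) (at 0)"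
      using tendsto_min [OF \<sigma> \<tau>] tendsto_max [OF \<sigma> \<tau>] by auto
    have "\<forall>\<^sub>F t in at (0::real). t \<noteq> 0" by (auto simp: eventually_at_filter)
    with ev show "\<forall>\<^sub>F t in at 0. min (\<sigma> t / t) (\<tau> t / t) \<le> c t / t"
      "\<forall>\<^sub>F t in at 0. c t / t \<le> max (\<sigma> t / t) (\<tau> t / t)"
      by (eventually_elim, auto simp: min_def max_def divide_simps split: if_splits)+
  qed
  have "((\<lambda>t. F' (c t) / t ^ p) \<longlongrightarrow> L * r ^ p) (at 0)"
    using F' cr r by (rule tendsto_div_power_compose)
  moreover have "\<forall>\<^sub>F t in at 0. F (\<sigma> t) - F (\<tau> t) = F' (c t) * (\<sigma> t - \<tau> t)"
    using ev by eventually_elim simp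
  ultimately show ?thesis by (rule that [rotated])
qed

section \<open>Arc-length parametrized plane curves\<close>

text \<open>
  \<open>(U, V)\<close> is a plane curve parametrized by arc length near \<open>0\<close>, with unit tangent \<open>(P, Q)\<close> and signed
  curvature \<open>\<kappa>\<close>, that starts at the origin in the direction of the first axis.
\<close>

definition frenet_germ ::
    "(real \<Rightarrow> real) \<Rightarrow> (real \<Rightarrow> real) \<Rightarrow> (real \<Rightarrow> real) \<Rightarrow> (real \<Rightarrow> real) \<Rightarrow> (real \<Rightarrow> real) \<Rightarrow> bool" where
  "frenet_germ \<kappa> U V P Q \<longleftrightarrow>
     U 0 = 0 \<and> V 0 = 0 \<and> P 0 = 1 \<and> Q 0 = 0 \<and>
     (\<forall>\<^sub>F s in nhds 0. (U has_real_derivative P s) (at s)) \<and>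
     (\<forall>\<^sub>F s in nhds 0. (V has_real_derivative Q s) (at s)) \<and>
     (\<forall>\<^sub>F s in nhds 0. (P has_real_derivative - (\<kappa> s * Q s)) (at s)) \<and>
     (\<forall>\<^sub>F s in nhds 0. (Q has_real_derivative \<kappa> s * P s) (at s))"

lemma tendsto_at_0_if_DERIV_near:
  fixes f :: "real \<Rightarrow> real"
  assumes "\<forall>\<^sub>F s in nhds 0. (f has_real_derivative f' s) (at s)"
  shows "(f \<longlongrightarrow> f 0) (at 0)"
  using DERIV_isCont [OF eventually_nhds_x_imp_x [OF assms]] by (simp add: isCont_def)

lemma frenet_germD:
  assumes "frenet_germ \<kappa> U V P Q"
  shows "U 0 = 0" "V 0 = 0" "P 0 = 1" "Q 0 = 0"
    and "\<forall>\<^sub>F s in nhds 0. (U has_real_derivative P s) (at s)"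
    and "\<forall>\<^sub>F s in nhds 0. (V has_real_derivative Q s) (at s)"
    and "\<forall>\<^sub>F s in nhds 0. (P has_real_derivative - (\<kappa> s * Q s)) (at s)"
    and "\<forall>\<^sub>F s in nhds 0. (Q has_real_derivative \<kappa> s * P s) (at s)"
  using assms by (simp_all add: frenet_germ_def)

lemma frenet_germ_leading_terms:
  assumes fr: "frenet_germ \<kappa> U V P Q" and \<kappa>: "(\<kappa> \<longlongrightarrow> k) (at 0)"
  shows "(P \<longlongrightarrow> 1) (at 0)" "((\<lambda>s. V s / s ^ 2) \<longlongrightarrow> k / 2) (at 0)"
    and "((\<lambda>s. \<kappa> s / s) \<longlongrightarrow> c) (at 0) \<Longrightarrow> ((\<lambda>s. Q s / s ^ 2) \<longlongrightarrow> c / 2) (at 0)"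
    and "((\<lambda>s. \<kappa> s / s) \<longlongrightarrow> c) (at 0) \<Longrightarrow> ((\<lambda>s. V s / s ^ 3) \<longlongrightarrow> c / 6) (at 0)"
proof -
  show P: "(P \<longlongrightarrow> 1) (at 0)"
    using tendsto_at_0_if_DERIV_near [OF frenet_germD(7) [OF fr]] frenet_germD(3) [OF fr] by simp
  have dQ: "\<forall>\<^sub>F s in nhds 0. (Q has_real_derivative \<kappa> s * P s) (at s)" and "Q 0 = 0"
    and dV: "\<forall>\<^sub>F s in nhds 0. (V has_real_derivative Q s) (at s)" and "V 0 = 0"
    by (rule frenet_germD [OF fr])+
  have "((\<lambda>s. \<kappa> s * P s / s ^ 0) \<longlongrightarrow> k) (at 0)"
    using tendsto_mult [OF \<kappa> P] by simp
  from tendsto_div_power_integrate [OF dV \<open>V 0 = 0\<close>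
      tendsto_div_power_integrate [OF dQ \<open>Q 0 = 0\<close> this]]
  show "((\<lambda>s. V s / s ^ 2) \<longlongrightarrow> k / 2) (at 0)"
    by (simp add: numeral_2_eq_2)
  assume c: "((\<lambda>s. \<kappa> s / s) \<longlongrightarrow> c) (at 0)"
  have "((\<lambda>s. \<kappa> s * P s / s ^ 1) \<longlongrightarrow> c) (at 0)"
    using tendsto_mult [OF c P] by simp
  note q = tendsto_div_power_integrate [OF dQ \<open>Q 0 = 0\<close> this]
  from q show "((\<lambda>s. Q s / s ^ 2) \<longlongrightarrow> c / 2) (at 0)"
    by (simp add: numeral_2_eq_2)
  from tendsto_div_power_integrate [OF dV \<open>V 0 = 0\<close> q]
  show "((\<lambda>s. V s / s ^ 3) \<longlongrightarrow> c / 6) (at 0)"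
    by (simp add: numeral_3_eq_3 add.commute)
qed

text \<open>
  A quantitative form of the uniqueness part of the fundamental theorem of plane curves.  The
  differences of the tangents solve a linear system whose inhomogeneity has the order of
  \<open>\<kappa> - \<kappa>'\<close>; feeding their order of vanishing back into the system raises it by one at a time, until
  the order of \<open>\<kappa> - \<kappa>'\<close> is reached.
\<close>

lemma frenet_germ_comparison:
  assumes fr: "frenet_germ \<kappa> U V P Q" and fr': "frenet_germ \<kappa>' U' V' P' Q'"
    and \<kappa>: "(\<kappa> \<longlongrightarrow> k) (at 0)"
    and N: "((\<lambda>s. (\<kappa> s - \<kappa>' s) / s ^ N) \<longlongrightarrow> 0) (at 0)"
  shows "((\<lambda>s. (U s - U' s) / s ^ (N + 2)) \<longlongrightarrow> 0) (at 0)"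
    and "((\<lambda>s. (V s - V' s) / s ^ (N + 2)) \<longlongrightarrow> 0) (at 0)"
proof -
  have diff: "\<forall>\<^sub>F s in nhds 0. ((\<lambda>s. f s - g s) has_real_derivative f' s - g' s) (at s)"
    if "\<forall>\<^sub>F s in nhds 0. (f has_real_derivative f' s) (at s)"
      "\<forall>\<^sub>F s in nhds 0. (g has_real_derivative g' s) (at s)" for f g f' g' :: "real \<Rightarrow> real"
    using that by eventually_elim (rule DERIV_diff)
  note dU = diff [OF frenet_germD(5) [OF fr] frenet_germD(5) [OF fr']]
  note dV = diff [OF frenet_germD(6) [OF fr] frenet_germD(6) [OF fr']]
  note dP0 = diff [OF frenet_germD(7) [OF fr] frenet_germD(7) [OF fr']]
  note dQ0 = diff [OF frenet_germD(8) [OF fr] frenet_germD(8) [OF fr']]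
  have ev0: "U 0 - U' 0 = 0" "V 0 - V' 0 = 0" "P 0 - P' 0 = 0" "Q 0 - Q' 0 = 0"
    by (simp_all add: frenet_germD(1-4) [OF fr] frenet_germD(1-4) [OF fr'])
  have dP: "\<forall>\<^sub>F s in nhds 0. ((\<lambda>s. P s - P' s) has_real_derivative
      - (\<kappa> s * (Q s - Q' s) + (\<kappa> s - \<kappa>' s) * Q' s)) (at s)"
    using dP0 by eventually_elim (simp add: algebra_simps)
  have dQ: "\<forall>\<^sub>F s in nhds 0. ((\<lambda>s. Q s - Q' s) has_real_derivative
      \<kappa> s * (P s - P' s) + (\<kappa> s - \<kappa>' s) * P' s) (at s)"
    using dQ0 by eventually_elim (simp add: algebra_simps)
  have P': "(P' \<longlongrightarrow> P' 0) (at 0)" and Q': "(Q' \<longlongrightarrow> Q' 0) (at 0)"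
    by (rule tendsto_at_0_if_DERIV_near [OF frenet_germD(7) [OF fr']]
        tendsto_at_0_if_DERIV_near [OF frenet_germD(8) [OF fr']])+
  have PQ: "((\<lambda>s. (P s - P' s) / s ^ j) \<longlongrightarrow> 0) (at 0) \<and> ((\<lambda>s. (Q s - Q' s) / s ^ j) \<longlongrightarrow> 0) (at 0)"
    if "j \<le> N + 1" for j
    using that
  proof (induction j)
    case 0
    then show ?case
      using tendsto_at_0_if_DERIV_near [OF dP0] tendsto_at_0_if_DERIV_near [OF dQ0] ev0 by simp
  next
    case (Suc j)
    have k: "((\<lambda>s. (\<kappa> s - \<kappa>' s) / s ^ j) \<longlongrightarrow> 0) (at 0)"
      using N tendsto_div_power_lower [OF N, of j] Suc.prems by (cases "j = N") auto
    have IH: "((\<lambda>s. (P s - P' s) / s ^ j) \<longlongrightarrow> 0) (at 0)" "((\<lambda>s. (Q s - Q' s) / s ^ j) \<longlongrightarrow> 0) (at 0)"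
      using Suc by auto
    have "((\<lambda>s. \<kappa> s * ((Q s - Q' s) / s ^ j) + (\<kappa> s - \<kappa>' s) / s ^ j * Q' s) \<longlongrightarrow>
        k * 0 + 0 * Q' 0) (at 0)"
      by (intro tendsto_intros \<kappa> k IH Q')
    then have "((\<lambda>s. (\<kappa> s * (Q s - Q' s) + (\<kappa> s - \<kappa>' s) * Q' s) / s ^ j) \<longlongrightarrow> 0) (at 0)"
      by (simp add: add_divide_distrib)
    from tendsto_minus [OF this]
    have 1: "((\<lambda>s. - (\<kappa> s * (Q s - Q' s) + (\<kappa> s - \<kappa>' s) * Q' s) / s ^ j) \<longlongrightarrow> 0) (at 0)"
      by (simp only: minus_divide_left minus_zero)
    have "((\<lambda>s. \<kappa> s * ((P s - P' s) / s ^ j) + (\<kappa> s - \<kappa>' s) / s ^ j * P' s) \<longlongrightarrow>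
        k * 0 + 0 * P' 0) (at 0)"
      by (intro tendsto_intros \<kappa> k IH P')
    then have 2: "((\<lambda>s. (\<kappa> s * (P s - P' s) + (\<kappa> s - \<kappa>' s) * P' s) / s ^ j) \<longlongrightarrow> 0) (at 0)"
      by (simp add: add_divide_distrib)
    show ?case
      using tendsto_div_power_integrate [OF dP ev0(3) 1] tendsto_div_power_integrate [OF dQ ev0(4) 2]
      by simp
  qed
  from PQ [of "N + 1"]
  have "((\<lambda>s. (P s - P' s) / s ^ (N + 1)) \<longlongrightarrow> 0) (at 0)" "((\<lambda>s. (Q s - Q' s) / s ^ (N + 1)) \<longlongrightarrow> 0) (at 0)"
    by simp_all
  from tendsto_div_power_integrate [OF dU ev0(1) this(1)] tendsto_div_power_integrate [OF dV ev0(2) this(2)]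
  show "((\<lambda>s. (U s - U' s) / s ^ (N + 2)) \<longlongrightarrow> 0) (at 0)"
    "((\<lambda>s. (V s - V' s) / s ^ (N + 2)) \<longlongrightarrow> 0) (at 0)"
    by simp_all
qed

section \<open>Projected curves in arc-length coordinates\<close>

lemma xi_components [simp]: "xi \<theta> $ 1 = cos \<theta>" "xi \<theta> $ 2 = sin \<theta>" "xi \<theta> $ 3 = 0"
  by (simp_all add: xi_def)

text \<open>
  The right-hand side is the Euclidean norm of the coordinates of the projection with respect to
  \<open>(sin \<theta>, - cos \<theta>, 0)\<close> and \<open>(0, 0, -1)\<close>; in the same coordinates \<open>det_xi\<close> below is the planar
  determinant of the projections of \<open>x\<close> and \<open>y\<close>.
\<close>

lemma norm_orth_proj_xi:
  "norm (orth_proj (xi \<theta>) x) = sqrt ((sin \<theta> * x $ 1 - cos \<theta> * x $ 2)\<^sup>2 + (x $ 3)\<^sup>2)"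
proof -
  let ?p = "sin \<theta> * x $ 1 - cos \<theta> * x $ 2"
  have cs: "cos \<theta> * cos \<theta> = 1 - sin \<theta> * sin \<theta>"
    using sin_cos_squared_add [of \<theta>] by (simp add: power2_eq_square)
  have "x $ 1 - (x $ 1 * cos \<theta> + x $ 2 * sin \<theta>) * cos \<theta> =
      x $ 1 - x $ 1 * (cos \<theta> * cos \<theta>) - x $ 2 * sin \<theta> * cos \<theta>"
    by (simp add: algebra_simps)
  also have "\<dots> = sin \<theta> * ?p"
    unfolding cs by (simp add: algebra_simps)
  finally have 1: "x $ 1 - (x $ 1 * cos \<theta> + x $ 2 * sin \<theta>) * cos \<theta> = sin \<theta> * ?p" .
  have "- (cos \<theta> * ?p) = x $ 2 * (cos \<theta> * cos \<theta>) - x $ 1 * cos \<theta> * sin \<theta>"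
    by (simp add: algebra_simps)
  also have "\<dots> = x $ 2 - (x $ 1 * cos \<theta> + x $ 2 * sin \<theta>) * sin \<theta>"
    unfolding cs by (simp add: algebra_simps)
  finally have 2: "x $ 2 - (x $ 1 * cos \<theta> + x $ 2 * sin \<theta>) * sin \<theta> = - (cos \<theta> * ?p)" ..
  have "(norm (orth_proj (xi \<theta>) x))\<^sup>2 = (sin \<theta> * ?p)\<^sup>2 + (- (cos \<theta> * ?p))\<^sup>2 + (x $ 3)\<^sup>2"
    unfolding power2_norm_eq_inner inner_vec_def sum_3 orth_proj_def
    by (simp add: 1 2 power2_eq_square)
  also have "(sin \<theta> * ?p)\<^sup>2 + (- (cos \<theta> * ?p))\<^sup>2 = ((sin \<theta>)\<^sup>2 + (cos \<theta>)\<^sup>2) * ?p\<^sup>2"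
    by (simp only: power2_minus power_mult_distrib distrib_right)
  finally have "(norm (orth_proj (xi \<theta>) x))\<^sup>2 = ?p\<^sup>2 + (x $ 3)\<^sup>2" by simp
  then show ?thesis by (metis norm_ge_zero real_sqrt_unique)
qed

lemma det_xi:
  "det (vector [x, y, xi \<theta>] :: real^3^3) =
     (sin \<theta> * x $ 1 - cos \<theta> * x $ 2) * - y $ 3 - (sin \<theta> * y $ 1 - cos \<theta> * y $ 2) * - x $ 3"
  by (simp add: det_3 vector_3 algebra_simps)

lemma has_real_derivative_arc_length:
  fixes J :: "real set"
  assumes J: "open J" "is_interval J" "0 \<in> J" and t: "t \<in> J"
    and cont: "continuous_on J (\<lambda>u. norm (vderiv 1 c u))"
  shows "(arc_length c has_real_derivative norm (vderiv 1 c t)) (at t)"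
proof -
  obtain e where e: "e > 0" "cball t e \<subseteq> J"
    using J(1) t open_contains_cball by blast
  define p q where "p = min 0 (t - e)" and "q = max 0 (t + e)"
  have "t - e \<in> J" "t + e \<in> J"
    using e by (auto simp: subset_iff dist_real_def)
  then have "p \<in> J" "q \<in> J"
    using J(3) by (auto simp: p_def q_def min_def max_def)
  then have sub: "{p..q} \<subseteq> J"
    using J(2) by (meson atLeastAtMost_iff mem_is_interval_1_I subsetI)
  have pq: "p \<le> 0" "0 \<le> q" "p < t" "t < q"
    using e(1) by (auto simp: p_def q_def)
  have "((\<lambda>u. LBINT y=ereal 0..u. norm (vderiv 1 c y)) has_vector_derivative norm (vderiv 1 c t))
      (at t within {p..q})"
    using pq continuous_on_subset [OF cont sub] by (intro interval_integral_FTC2) auto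
  then have "((\<lambda>u. LBINT y=ereal 0..u. norm (vderiv 1 c y)) has_vector_derivative norm (vderiv 1 c t))
      (at t within {p<..<q})"
    by (rule has_vector_derivative_within_subset) auto
  then have "((\<lambda>u. LBINT y=ereal 0..u. norm (vderiv 1 c y)) has_vector_derivative norm (vderiv 1 c t))
      (at t)"
    using pq by (simp add: has_vector_derivative_within_open [of _ "{p<..<q}"])
  then show ?thesis
    by (simp add: has_real_derivative_iff_has_vector_derivative arc_length_def [abs_def] zero_ereal_def)
qed

lemma arc_length_0 [simp]: "arc_length c 0 = 0"
  by (simp add: arc_length_def zero_ereal_def)

lemma inverse_of_increasing_function:
  fixes \<sigma> \<rho> :: "real \<Rightarrow> real"
  assumes J: "open J" "is_interval J"
    and \<sigma>: "\<And>t. t \<in> J \<Longrightarrow> (\<sigma> has_real_derivative \<rho> t) (at t)" "\<And>t. t \<in> J \<Longrightarrow> \<rho> t > 0"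
  shows "inj_on \<sigma> J" "open (\<sigma> ` J)"
    and "\<And>s. s \<in> \<sigma> ` J \<Longrightarrow> (inv_into J \<sigma> has_real_derivative inverse (\<rho> (inv_into J \<sigma> s))) (at s)"
proof -
  have less: "\<sigma> x < \<sigma> y" if "x \<in> J" "y \<in> J" "x < y" for x y
  proof (rule DERIV_pos_imp_increasing [OF \<open>x < y\<close>])
    fix z assume "x \<le> z" "z \<le> y"
    then have "z \<in> J" using that J(2) by (meson mem_is_interval_1_I)
    then show "\<exists>r. (\<sigma> has_real_derivative r) (at z) \<and> 0 < r" using \<sigma> by blast
  qed
  show inj: "inj_on \<sigma> J"
    by (rule linorder_inj_onI') (use less in force)
  have cont: "continuous_on J \<sigma>"
    by (intro continuous_at_imp_continuous_on ballI DERIV_isCont) (rule \<sigma>(1))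
  show op: "open (\<sigma> ` J)"
    using cont J(1) inj by (rule invariance_of_domain)
  have contT: "continuous_on (\<sigma> ` J) (inv_into J \<sigma>)"
    using inj by (intro continuous_on_inverse_open J(1) cont) simp_all
  fix s assume s: "s \<in> \<sigma> ` J"
  obtain e where e: "e > 0" "ball s e \<subseteq> \<sigma> ` J"
    using op s open_contains_ball by blast
  show "(inv_into J \<sigma> has_real_derivative inverse (\<rho> (inv_into J \<sigma> s))) (at s)"
  proof (rule DERIV_inverse_function)
    have T: "inv_into J \<sigma> s \<in> J" using s by (rule inv_into_into)
    show "(\<sigma> has_real_derivative \<rho> (inv_into J \<sigma> s)) (at (inv_into J \<sigma> s))"
      by (rule \<sigma>(1) [OF T])
    show "\<rho> (inv_into J \<sigma> s) \<noteq> 0" using \<sigma>(2) [OF T] by simp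
    show "s - e < s" "s < s + e" using e by auto
    show "\<sigma> (inv_into J \<sigma> y) = y" if "s - e < y" "y < s + e" for y
      by (rule f_inv_into_f, rule subsetD [OF e(2)]) (use that in \<open>auto simp: dist_real_def\<close>)
    show "isCont (inv_into J \<sigma>) s"
      using contT op s continuous_on_eq_continuous_at by blast
  qed
qed

lemma has_real_derivative_at_0_iff_quotient:
  fixes f :: "real \<Rightarrow> real"
  assumes "f 0 = 0"
  shows "(f has_real_derivative D) (at 0) \<longleftrightarrow> ((\<lambda>t. f t / t) \<longlongrightarrow> D) (at 0)"
  using assms by (simp add: DERIV_def)

text \<open>
  The Frenet equation \<open>P' = - \<kappa> Q\<close> after all derivatives have been carried out: \<open>(X, Y)\<close> is the
  velocity, \<open>(x, y)\<close> the acceleration and \<open>r\<close> the reciprocal of the speed.  Exchanging the coordinates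
  gives the equation \<open>Q' = \<kappa> P\<close>.
\<close>

lemma unit_tangent_derivative_identity:
  fixes X Y x y r :: real
  assumes "r * r * (X\<^sup>2 + Y\<^sup>2) = 1"
  shows "x * r * r + - ((X * x + Y * y) * (r * (r * r))) * r * X =
    - ((X * y - x * Y) * (r * (r * r)) * (Y * r))"
proof -
  have "x * r * r + - ((X * x + Y * y) * (r * (r * r))) * r * X -
      - ((X * y - x * Y) * (r * (r * r)) * (Y * r)) = x * r * r * (1 - r * r * (X\<^sup>2 + Y\<^sup>2))"
    by (simp add: algebra_simps power2_eq_square)
  then show ?thesis using assms by simp
qed

text \<open>
  Reparametrization of a regular plane curve \<open>(u 0, v 0)\<close> by arc length \<open>\<sigma>\<close>; the sequences \<open>u\<close> and \<open>v\<close>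
  list the successive derivatives of the coordinates.  With \<open>T\<close> the inverse of \<open>\<sigma>\<close> and \<open>R\<close> the
  reciprocal speed, the frame is \<open>P = (u 1 \<cdot> R) \<circ> T\<close> and \<open>Q = (v 1 \<cdot> R) \<circ> T\<close>, and \<open>\<kappa>\<close> is smooth
  because it is built from smooth functions by products, real powers and composition with \<open>T\<close>.
\<close>

lemma frenet_germ_of_plane_curve:
  fixes u v :: "nat \<Rightarrow> real \<Rightarrow> real" and w :: "real \<Rightarrow> real"
  assumes J: "open J" "is_interval J" "0 \<in> J"
    and u: "\<And>i t. t \<in> J \<Longrightarrow> (u i has_real_derivative u (Suc i) t) (at t)"
    and v: "\<And>i t. t \<in> J \<Longrightarrow> (v i has_real_derivative v (Suc i) t) (at t)"
    and w: "\<And>t. w t = (u 1 t)\<^sup>2 + (v 1 t)\<^sup>2" "\<And>t. t \<in> J \<Longrightarrow> w t > 0"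
    and zero: "u 0 0 = 0" "v 0 0 = 0" "v 1 0 = 0" "u 1 0 > 0"
    and \<sigma>: "\<And>t. t \<in> J \<Longrightarrow> (\<sigma> has_real_derivative sqrt (w t)) (at t)" "\<sigma> 0 = 0"
    and \<kappa>: "\<And>s. s \<in> \<sigma> ` J \<Longrightarrow> \<kappa> s = (let t = inv_into J \<sigma> s
               in (u 1 t * v 2 t - u 2 t * v 1 t) / sqrt (w t) ^ 3)"
  obtains U V P Q where "frenet_germ \<kappa> U V P Q"
    and "\<forall>\<^sub>F t in at 0. u 0 t = U (\<sigma> t) \<and> v 0 t = V (\<sigma> t)"
    and "\<forall>i. \<forall>\<^sub>F s in nhds 0. ((deriv ^^ i) \<kappa> has_real_derivative (deriv ^^ Suc i) \<kappa> s) (at s)"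
proof -
  define T where "T = inv_into J \<sigma>"
  define R where "R t = w t powr - (1 / 2)" for t
  define K where "K t = (u 1 t * v 2 t - u 2 t * v 1 t) * (R t * (R t * R t))" for t
  let ?S = "\<sigma> ` J"
  have Rsqrt: "R t = inverse (sqrt (w t))" if "t \<in> J" for t
    using w(2) [OF that] by (simp add: R_def powr_minus powr_half_sqrt)
  have Rw: "R t * R t * w t = 1" if "t \<in> J" for t
    using w(2) [OF that] by (simp add: Rsqrt [OF that] flip: inverse_mult_distrib)
  have inj: "inj_on \<sigma> J" and op: "open ?S"
    and dT0: "\<And>s. s \<in> ?S \<Longrightarrow> (T has_real_derivative inverse (sqrt (w (T s)))) (at s)"
    unfolding T_def using inverse_of_increasing_function [OF J(1,2) \<sigma>(1)] w(2) by auto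
  have TJ: "T s \<in> J" if "s \<in> ?S" for s
    using that unfolding T_def by (rule inv_into_into)
  have T\<sigma>: "T (\<sigma> t) = t" if "t \<in> J" for t
    unfolding T_def using inj that by (rule inv_into_f_f)
  have S0: "0 \<in> ?S" using J(3) \<sigma>(2) by force
  have T0: "T 0 = 0" using T\<sigma> [OF J(3)] \<sigma>(2) by simp
  have dT: "(T has_real_derivative R (T s)) (at s)" if "s \<in> ?S" for s
    using dT0 [OF that] Rsqrt [OF TJ [OF that]] by simp
  have du: "(u 0 has_real_derivative u 1 t) (at t)" "(u 1 has_real_derivative u 2 t) (at t)"
    and dv: "(v 0 has_real_derivative v 1 t) (at t)" "(v 1 has_real_derivative v 2 t) (at t)"
    if "t \<in> J" for t
    using u [OF that, of 0] u [OF that, of 1] v [OF that, of 0] v [OF that, of 1]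
    by (simp_all add: numeral_2_eq_2)
  have dw: "(w has_real_derivative 2 * (u 1 t * u 2 t + v 1 t * v 2 t)) (at t)" if "t \<in> J" for t
    unfolding w(1) [abs_def]
    by (rule derivative_eq_intros du [OF that] dv [OF that] refl | simp)+
  have dR: "(R has_real_derivative - ((u 1 t * u 2 t + v 1 t * v 2 t) * (R t * (R t * R t)))) (at t)"
    if "t \<in> J" for t
  proof -
    have "w t powr (- (1 / 2) - 1) = w t powr - (1 / 2) * (w t powr - (1 / 2) * w t powr - (1 / 2))"
      unfolding powr_add [symmetric] by simp
    moreover have "2 * (u 1 t * u 2 t + v 1 t * v 2 t) = (u 1 t * u 2 t + v 1 t * v 2 t) * 2" by simp
    ultimately show ?thesis
      unfolding R_def [abs_def]
      by (intro DERIV_cong [OF DERIV_chain2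
            [OF has_real_derivative_powr [OF w(2) [OF that], of "- (1 / 2)"] dw [OF that]]])
        (simp only:, simp)
  qed
  have \<kappa>K: "\<kappa> s = K (T s)" if "s \<in> ?S" for s
  proof -
    have "inverse (sqrt (w (T s)) ^ 3) = R (T s) * (R (T s) * R (T s))"
      by (simp only: Rsqrt [OF TJ [OF that]] power3_eq_cube inverse_mult_distrib mult.assoc)
    then show ?thesis
      unfolding \<kappa> [OF that] K_def T_def [symmetric] Let_def divide_inverse by (simp only:)
  qed
  have nearS: "\<forall>\<^sub>F s in nhds 0. s \<in> ?S" using op S0 by (rule eventually_nhds_in_open)
  have "frenet_germ \<kappa> (\<lambda>s. u 0 (T s)) (\<lambda>s. v 0 (T s)) (\<lambda>s. u 1 (T s) * R (T s)) (\<lambda>s. v 1 (T s) * R (T s))"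
    unfolding frenet_germ_def
  proof (intro conjI)
    have "sqrt (w 0) = u 1 0" using zero w(1) by simp
    then show "u 1 (T 0) * R (T 0) = 1" using zero(4) by (simp add: T0 Rsqrt J(3))
    have chain: "((\<lambda>s. f (T s)) has_real_derivative f' (T s) * R (T s)) (at s)"
      if "s \<in> ?S" "\<And>t. t \<in> J \<Longrightarrow> (f has_real_derivative f' t) (at t)" for f f' s
      using DERIV_chain2 [OF that(2) [OF TJ [OF that(1)]] dT [OF that(1)]] .
    show "\<forall>\<^sub>F s in nhds 0. ((\<lambda>s. u 0 (T s)) has_real_derivative u 1 (T s) * R (T s)) (at s)"
      using nearS by eventually_elim (rule chain [OF _ du(1)])
    show "\<forall>\<^sub>F s in nhds 0. ((\<lambda>s. v 0 (T s)) has_real_derivative v 1 (T s) * R (T s)) (at s)"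
      using nearS by eventually_elim (rule chain [OF _ dv(1)])
    show "\<forall>\<^sub>F s in nhds 0. ((\<lambda>s. u 1 (T s) * R (T s)) has_real_derivative
        - (\<kappa> s * (v 1 (T s) * R (T s)))) (at s)"
      using nearS
    proof eventually_elim
      case (elim s)
      let ?t = "T s" and ?r = "R (T s)"
      let ?X = "u 1 ?t" and ?x = "u 2 ?t" and ?Y = "v 1 ?t" and ?y = "v 2 ?t"
      have "?x * ?r * ?r + - ((?X * ?x + ?Y * ?y) * (?r * (?r * ?r))) * ?r * ?X =
          - (K ?t * (?Y * ?r))"
        unfolding K_def using Rw [OF TJ [OF elim]]
        by (intro unit_tangent_derivative_identity) (simp only: w(1))
      with DERIV_mult [OF chain [OF elim du(2)] chain [OF elim dR]] show ?case
        by (simp add: \<kappa>K [OF elim])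
    qed
    show "\<forall>\<^sub>F s in nhds 0. ((\<lambda>s. v 1 (T s) * R (T s)) has_real_derivative
        \<kappa> s * (u 1 (T s) * R (T s))) (at s)"
      using nearS
    proof eventually_elim
      case (elim s)
      let ?t = "T s" and ?r = "R (T s)"
      let ?X = "u 1 ?t" and ?x = "u 2 ?t" and ?Y = "v 1 ?t" and ?y = "v 2 ?t"
      have "?y * ?r * ?r + - ((?Y * ?y + ?X * ?x) * (?r * (?r * ?r))) * ?r * ?Y =
          - ((?Y * ?x - ?y * ?X) * (?r * (?r * ?r)) * (?X * ?r))"
        using Rw [OF TJ [OF elim]]
        by (intro unit_tangent_derivative_identity) (simp only: w(1) add.commute)
      also have "\<dots> = K ?t * (?X * ?r)"
        unfolding K_def by (simp only: mult.commute [of ?y] mult.commute [of ?x] minus_mult_left minus_diff_eq)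
      finally have "?y * ?r * ?r + - ((?X * ?x + ?Y * ?y) * (?r * (?r * ?r))) * ?r * ?Y =
          K ?t * (?X * ?r)"
        by (simp only: add.commute [of "?X * ?x"])
      with DERIV_mult [OF chain [OF elim dv(2)] chain [OF elim dR]] show ?case
        by (simp add: \<kappa>K [OF elim])
    qed
  qed (simp_all add: T0 zero zero(3) [simplified])
  moreover have "\<forall>\<^sub>F t in at 0. u 0 t = u 0 (T (\<sigma> t)) \<and> v 0 t = v 0 (T (\<sigma> t))"
    using eventually_nhds_in_open [OF J(1,3)] 
    by (auto simp: eventually_at_filter T\<sigma> elim: eventually_mono)
  moreover have "\<forall>\<^sub>F s in nhds 0. ((deriv ^^ i) \<kappa> has_real_derivative (deriv ^^ Suc i) \<kappa> s) (at s)" for i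
  proof -
    have Rn: "ndiff n J R" for n
    proof -
      have "ndiff n J (\<lambda>t. u 1 t * u 1 t + v 1 t * v 1 t)"
        by (intro ndiff_add ndiff_mult ndiff_sequence u v)
      then have "ndiff n J w" unfolding w(1) [abs_def] by (simp add: power2_eq_square)
      then show ?thesis
        unfolding R_def [abs_def] by (rule ndiff_compose [OF _ ndiff_powr]) (use w(2) in auto)
    qed
    have Kn: "ndiff n J K" for n
      unfolding K_def [abs_def] by (intro ndiff_diff ndiff_mult ndiff_sequence u v Rn)
    have Tn: "ndiff n ?S T" for n
      using dT _ Rn by (rule ndiff_autonomous_solution [where h = R and J = J]) (use TJ in auto)
    have "ndiff (Suc i) ?S (\<lambda>s. K (T s))"
      by (rule ndiff_compose [OF Tn Kn]) (use TJ in auto)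
    then have "ndiff (Suc i) ?S \<kappa>"
      by (rule ndiff_cong [OF op _, rotated]) (simp add: \<kappa>K)
    from ndiff_funpow_deriv [OF op this] show ?thesis
      using nearS by (auto elim: eventually_mono)
  qed
  ultimately show ?thesis by (intro that allI)
qed

text \<open>
  On the interval \<open>regular_part\<close> the projected speed is positive, so arc length is injective there and
  its inverse is the function used in \<open>curvature_of_arc_length\<close>.  The three limits say that \<open>\<gamma>\<close>
  leaves the origin with velocity \<open>(1, 0, 0)\<close>.
\<close>

lemma projected_curve_frenet_germ:
  fixes \<gamma> :: "real \<Rightarrow> real^3" and \<kappa> :: "real \<Rightarrow> real" and I :: "real set" and \<theta> :: real
  defines "\<kappa> \<equiv> curvature_of_arc_length I \<gamma> \<theta>"
  assumes reg: "regular_smooth_curve I \<gamma>" and \<gamma>0: "\<gamma> 0 = 0"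
    and x: "((\<lambda>t. \<gamma> t $ 1 / t) \<longlongrightarrow> 1) (at 0)"
    and y: "((\<lambda>t. \<gamma> t $ 2 / t) \<longlongrightarrow> 0) (at 0)"
    and z: "((\<lambda>t. \<gamma> t $ 3 / t) \<longlongrightarrow> 0) (at 0)"
    and \<theta>: "0 < sin \<theta>"
  obtains U V P Q \<sigma> where "frenet_germ \<kappa> U V P Q"
    and "((\<lambda>t. \<sigma> t / t) \<longlongrightarrow> sin \<theta>) (at 0)"
    and "\<forall>\<^sub>F t in at 0. sin \<theta> * \<gamma> t $ 1 - cos \<theta> * \<gamma> t $ 2 = U (\<sigma> t) \<and> - \<gamma> t $ 3 = V (\<sigma> t)"
    and "\<forall>i. \<forall>\<^sub>F s in nhds 0. ((deriv ^^ i) \<kappa> has_real_derivative (deriv ^^ Suc i) \<kappa> s) (at s)"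
proof -
  define c where "c = projected_curve \<gamma> \<theta>"
  define u where "u i t = sin \<theta> * vderiv i \<gamma> t $ 1 - cos \<theta> * vderiv i \<gamma> t $ 2" for i t
  define v where "v i t = - vderiv i \<gamma> t $ 3" for i t
  define w where "w t = (u 1 t)\<^sup>2 + (v 1 t)\<^sup>2" for t
  define J where "J = regular_part I c"
  have I: "open I" "0 \<in> I" and diff: "\<And>n t. t \<in> I \<Longrightarrow> vderiv n \<gamma> differentiable (at t)"
    using reg by (auto simp: regular_smooth_curve_def)
  have comp: "((\<lambda>t. vderiv i \<gamma> t $ k) has_real_derivative vderiv (Suc i) \<gamma> t $ k) (at t)"
    if "t \<in> I" for i t k
  proof -
    have "(vderiv i \<gamma> has_vector_derivative vderiv (Suc i) \<gamma> t) (at t)"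
      using diff [OF that] by (simp add: vderiv_def vector_derivative_works)
    from bounded_linear.has_vector_derivative [OF bounded_linear_vec_nth this]
    show ?thesis by (simp add: has_real_derivative_iff_has_vector_derivative)
  qed
  have du: "(u i has_real_derivative u (Suc i) t) (at t)" if "t \<in> I" for i t
    unfolding u_def [abs_def] by (intro DERIV_diff DERIV_cmult comp that)
  have dv: "(v i has_real_derivative v (Suc i) t) (at t)" if "t \<in> I" for i t
    unfolding v_def [abs_def] by (intro DERIV_minus comp that)
  have v0\<gamma>: "vderiv 0 \<gamma> = \<gamma>" by (simp add: vderiv_def)
  have u00: "u 0 0 = 0" and v00: "v 0 0 = 0"
    by (simp_all add: u_def v_def v0\<gamma> \<gamma>0)
  have "((\<lambda>t. sin \<theta> * (\<gamma> t $ 1 / t) - cos \<theta> * (\<gamma> t $ 2 / t)) \<longlongrightarrow> sin \<theta> * 1 - cos \<theta> * 0) (at 0)"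
    by (intro tendsto_intros x y)
  then have "((\<lambda>t. u 0 t / t) \<longlongrightarrow> sin \<theta>) (at 0)"
    by (simp add: u_def v0\<gamma> diff_divide_distrib)
  then have "(u 0 has_real_derivative sin \<theta>) (at 0)"
    using has_real_derivative_at_0_iff_quotient [of "u 0", OF u00] by simp
  then have u10: "u 1 0 = sin \<theta>"
    using DERIV_unique [OF _ du [OF I(2), of 0]] by simp
  then have u10_pos: "0 < u 1 0" using \<theta> by simp
  have "((\<lambda>t. v 0 t / t) \<longlongrightarrow> 0) (at 0)"
    using tendsto_minus [OF z] by (simp add: v_def v0\<gamma>)
  then have "(v 0 has_real_derivative 0) (at 0)"
    using has_real_derivative_at_0_iff_quotient [of "v 0", OF v00] by simp
  then have v10: "v 1 0 = 0"
    using DERIV_unique [OF _ dv [OF I(2), of 0]] by simp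
  have speed: "norm (vderiv 1 c t) = sqrt (w t)" if "t \<in> I" for t
    using vderiv_projected_curve [OF reg that, of 1 \<theta>]
    by (simp add: c_def norm_orth_proj_xi w_def u_def v_def)
  have wnn: "w t \<ge> 0" for t by (simp add: w_def)
  have wpos: "vderiv 1 c t \<noteq> 0 \<longleftrightarrow> w t > 0" if "t \<in> I" for t
  proof -
    have "vderiv 1 c t = 0 \<longleftrightarrow> w t = 0" using speed [OF that] by (metis norm_eq_zero real_sqrt_eq_zero_cancel_iff)
    then show ?thesis using wnn [of t] by linarith
  qed
  have contw: "continuous_on I w"
    unfolding w_def [abs_def]
    by (intro continuous_intros continuous_at_imp_continuous_on ballI)
       (use du dv DERIV_isCont in blast)+
  have Jeq: "J = connected_component_set {t \<in> I. w t > 0} 0"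
    unfolding J_def regular_part_def using wpos by (metis (no_types, lifting) Collect_cong)
  have opw: "open {t \<in> I. w t > 0}"
    using continuous_open_preimage [OF contw I(1) open_greaterThan [of 0]]
    by (simp add: vimage_def Int_def)
  have J: "open J" "is_interval J"
    unfolding Jeq by (auto simp: open_connected_component opw is_interval_connected_1)
  have "0 \<in> {t \<in> I. w t > 0}" using I(2) \<theta> u10 by (simp add: w_def v10 [simplified])
  then have J0: "0 \<in> J" unfolding Jeq by simp
  have Jsub: "J \<subseteq> {t \<in> I. w t > 0}"
    unfolding Jeq by (rule connected_component_subset)
  then have JI: "t \<in> I" and Jw: "w t > 0" if "t \<in> J" for t using that by auto
  let ?\<sigma> = "arc_length c"
  have "continuous_on J (\<lambda>t. sqrt (w t))"
    using Jsub by (intro continuous_intros continuous_on_subset [OF contw]) auto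
  then have "continuous_on J (\<lambda>t. norm (vderiv 1 c t))"
    by (rule continuous_on_eq) (rule speed [OF JI, symmetric])
  from has_real_derivative_arc_length [OF J J0 _ this]
  have d\<sigma>: "(?\<sigma> has_real_derivative sqrt (w t)) (at t)" if "t \<in> J" for t
    using that speed [OF JI [OF that]] by fastforce
  have \<kappa>: "\<kappa> s = (let t = inv_into J ?\<sigma> s
               in (u 1 t * v 2 t - u 2 t * v 1 t) / sqrt (w t) ^ 3)" if "s \<in> ?\<sigma> ` J" for s
  proof -
    let ?t = "inv_into J ?\<sigma> s"
    have t: "?t \<in> I" using JI [OF inv_into_into [OF that]] .
    have "\<kappa> s = plane_curvature (xi \<theta>) c ?t"
      by (simp add: \<kappa>_def curvature_of_arc_length_def Let_def c_def J_def)
    also have "\<dots> = det (vector [vderiv 1 \<gamma> ?t, vderiv 2 \<gamma> ?t, xi \<theta>] :: real^3^3) / sqrt (w ?t) ^ 3"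
      using plane_curvature_projected_curve [OF reg t, of \<theta>]
      unfolding c_def [symmetric] speed [OF t] .
    finally show ?thesis by (simp add: Let_def det_xi u_def v_def)
  qed
  obtain U V P Q where "frenet_germ \<kappa> U V P Q"
    "\<forall>\<^sub>F t in at 0. u 0 t = U (?\<sigma> t) \<and> v 0 t = V (?\<sigma> t)"
    "\<forall>i. \<forall>\<^sub>F s in nhds 0. ((deriv ^^ i) \<kappa> has_real_derivative (deriv ^^ Suc i) \<kappa> s) (at s)"
    by (rule frenet_germ_of_plane_curve [OF J J0 du [OF JI] dv [OF JI] w_def Jw u00 v00 v10 u10_pos
          d\<sigma> arc_length_0 \<kappa>])
  moreover have "((\<lambda>t. ?\<sigma> t / t) \<longlongrightarrow> sin \<theta>) (at 0)"
  proof -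
    have "sqrt (w 0) = sin \<theta>" using \<theta> by (simp add: w_def u10 [simplified] v10 [simplified])
    then show ?thesis
      using d\<sigma> [OF J0] has_real_derivative_at_0_iff_quotient [of ?\<sigma>] by simp
  qed
  ultimately show ?thesis
    by (intro that [of U V P Q ?\<sigma>]) (simp_all add: u_def v_def v0\<gamma>)
qed

section \<open>Comparison of curves in normal form\<close>

lemma normal_form_difference_limits:
  assumes nf: "normal_form k \<gamma> a b" and nf': "normal_form k \<gamma>' a' b'"
  shows "m \<le> k \<Longrightarrow> ((\<lambda>t. (\<gamma> t $ 1 - \<gamma>' t $ 1) / t ^ m) \<longlongrightarrow> 0) (at 0)"
    and "2 \<le> m \<Longrightarrow> m \<le> k \<Longrightarrow> (\<And>i. 2 \<le> i \<Longrightarrow> i < m \<Longrightarrow> a i = a' i) \<Longrightarrow>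
      ((\<lambda>t. (\<gamma> t $ 2 - \<gamma>' t $ 2) / t ^ m) \<longlongrightarrow> (a m - a' m) / fact m) (at 0)"
    and "3 \<le> m \<Longrightarrow> m \<le> k \<Longrightarrow> (\<And>i. 3 \<le> i \<Longrightarrow> i < m \<Longrightarrow> b i = b' i) \<Longrightarrow>
      ((\<lambda>t. (\<gamma> t $ 3 - \<gamma>' t $ 3) / t ^ m) \<longlongrightarrow> (b m - b' m) / fact m) (at 0)"
proof -
  assume m: "m \<le> k"
  have "((\<lambda>t. ((\<gamma> t $ 1 - t) - (\<gamma>' t $ 1 - t)) / t ^ m) \<longlongrightarrow> 0 - 0) (at 0)"
    by (rule polynomial_difference_limit [where j = 0 and k = k and p = "\<lambda>i. 0" and q = "\<lambda>i. 0"])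
       (use nf nf' m in \<open>simp_all add: normal_form_def\<close>)
  then show "((\<lambda>t. (\<gamma> t $ 1 - \<gamma>' t $ 1) / t ^ m) \<longlongrightarrow> 0) (at 0)" by simp
next
  assume m: "2 \<le> m" "m \<le> k" "\<And>i. 2 \<le> i \<Longrightarrow> i < m \<Longrightarrow> a i = a' i"
  have "((\<lambda>t. (\<gamma> t $ 2 - \<gamma>' t $ 2) / t ^ m) \<longlongrightarrow> a m / fact m - a' m / fact m) (at 0)"
    by (rule polynomial_difference_limit [where j = 2 and k = k and
          p = "\<lambda>i. a i / fact i" and q = "\<lambda>i. a' i / fact i"])
       (use nf nf' m in \<open>simp_all add: normal_form_def\<close>)
  then show "((\<lambda>t. (\<gamma> t $ 2 - \<gamma>' t $ 2) / t ^ m) \<longlongrightarrow> (a m - a' m) / fact m) (at 0)"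
    by (simp add: diff_divide_distrib)
next
  assume m: "3 \<le> m" "m \<le> k" "\<And>i. 3 \<le> i \<Longrightarrow> i < m \<Longrightarrow> b i = b' i"
  have "((\<lambda>t. (\<gamma> t $ 3 - \<gamma>' t $ 3) / t ^ m) \<longlongrightarrow> b m / fact m - b' m / fact m) (at 0)"
    by (rule polynomial_difference_limit [where j = 3 and k = k and
          p = "\<lambda>i. b i / fact i" and q = "\<lambda>i. b' i / fact i"])
       (use nf nf' m in \<open>simp_all add: normal_form_def\<close>)
  then show "((\<lambda>t. (\<gamma> t $ 3 - \<gamma>' t $ 3) / t ^ m) \<longlongrightarrow> (b m - b' m) / fact m) (at 0)"
    by (simp add: diff_divide_distrib)
qed

text \<open>
  Comparing a curve with this line turns statements about differences of two curves into statements
  about a single one.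
\<close>

lemma normal_form_line: "normal_form k (\<lambda>t. vector [t, 0, 0]) (\<lambda>i. 0) (\<lambda>i. 0)"
  by (simp add: normal_form_def)

lemma normal_form_leading_terms:
  assumes nf: "normal_form k \<gamma> a b" and k: "3 \<le> k"
  shows "((\<lambda>t. \<gamma> t $ 1 / t) \<longlongrightarrow> 1) (at 0)" "((\<lambda>t. \<gamma> t $ 2 / t) \<longlongrightarrow> 0) (at 0)"
    and "((\<lambda>t. \<gamma> t $ 3 / t ^ 3) \<longlongrightarrow> b 3 / 6) (at 0)"
proof -
  note lim = normal_form_difference_limits [OF nf normal_form_line]
  have "((\<lambda>t. (\<gamma> t $ 1 - t) / t ^ 1 + 1) \<longlongrightarrow> 0 + 1) (at 0)"
    by (intro tendsto_add tendsto_const) (use lim(1) [of 1] k in simp)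
  moreover have "\<forall>\<^sub>F t in at 0. (\<gamma> t $ 1 - t) / t ^ 1 + 1 = \<gamma> t $ 1 / t"
    using eventually_neq_at_within [of 0 0 UNIV] by eventually_elim (simp add: field_simps)
  ultimately show "((\<lambda>t. \<gamma> t $ 1 / t) \<longlongrightarrow> 1) (at 0)"
    by (simp add: tendsto_cong)
  have "((\<lambda>t. \<gamma> t $ 2 / t ^ 2) \<longlongrightarrow> a 2 / 2) (at 0)"
    using lim(2) [of 2] k by simp
  from tendsto_div_power_lower [OF this, of 1] show "((\<lambda>t. \<gamma> t $ 2 / t) \<longlongrightarrow> 0) (at 0)" by simp
  show "((\<lambda>t. \<gamma> t $ 3 / t ^ 3) \<longlongrightarrow> b 3 / 6) (at 0)"
    using lim(3) [of 3] k by (simp add: fact_numeral)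
qed

text \<open>
  The vanishing of \<open>\<kappa> 0\<close> and the value of its derivative are read off from the height \<open>- z\<close>, whose
  expansion begins with \<open>- b\<^sub>3 t^3 / 6\<close>: on the other side \<open>V\<close> begins with \<open>\<kappa>(0) s^2 / 2\<close>, and with
  \<open>\<kappa>'(0) s^3 / 6\<close> once \<open>\<kappa>(0) = 0\<close> is known.
\<close>

lemma projected_frame_in_normal_form:
  fixes \<gamma> :: "real \<Rightarrow> real^3" and \<kappa> :: "real \<Rightarrow> real" and I :: "real set" and \<theta> :: real
  defines "\<kappa> \<equiv> curvature_of_arc_length I \<gamma> \<theta>"
  assumes "regular_smooth_curve I \<gamma>" "\<gamma> 0 = 0" and nf: "normal_form k \<gamma> a b" "3 \<le> k"
    and \<theta>: "0 < sin \<theta>"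
  obtains U V P Q \<sigma> where "frenet_germ \<kappa> U V P Q"
    and "((\<lambda>t. \<sigma> t / t) \<longlongrightarrow> sin \<theta>) (at 0)"
    and "\<forall>\<^sub>F t in at 0. sin \<theta> * \<gamma> t $ 1 - cos \<theta> * \<gamma> t $ 2 = U (\<sigma> t) \<and> - \<gamma> t $ 3 = V (\<sigma> t)"
    and "\<forall>i. \<forall>\<^sub>F s in nhds 0. ((deriv ^^ i) \<kappa> has_real_derivative (deriv ^^ Suc i) \<kappa> s) (at s)"
    and "(\<kappa> \<longlongrightarrow> 0) (at 0)"
    and "((\<lambda>s. \<kappa> s / s) \<longlongrightarrow> - b 3 / sin \<theta> ^ 3) (at 0)"
    and "deriv \<kappa> 0 = - b 3 / sin \<theta> ^ 3"
proof -
  note lead = normal_form_leading_terms [OF nf]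
  have z: "((\<lambda>t. \<gamma> t $ 3 / t) \<longlongrightarrow> 0) (at 0)"
    using tendsto_div_power_lower [OF lead(3), of 1] by simp
  obtain U V P Q \<sigma> where fr: "frenet_germ \<kappa> U V P Q"
    and \<sigma>: "((\<lambda>t. \<sigma> t / t) \<longlongrightarrow> sin \<theta>) (at 0)"
    and uv: "\<forall>\<^sub>F t in at 0. sin \<theta> * \<gamma> t $ 1 - cos \<theta> * \<gamma> t $ 2 = U (\<sigma> t) \<and> - \<gamma> t $ 3 = V (\<sigma> t)"
    and sm: "\<forall>i. \<forall>\<^sub>F s in nhds 0. ((deriv ^^ i) \<kappa> has_real_derivative (deriv ^^ Suc i) \<kappa> s) (at s)"
    using projected_curve_frenet_germ [OF assms(2,3) lead(1,2) z \<theta>] unfolding \<kappa>_def by blast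
  have "\<forall>\<^sub>F s in nhds 0. (\<kappa> has_real_derivative deriv \<kappa> s) (at s)"
    using sm [rule_format, of 0] by simp
  then have \<kappa>lim: "(\<kappa> \<longlongrightarrow> \<kappa> 0) (at 0)" and d\<kappa>: "(\<kappa> has_real_derivative deriv \<kappa> 0) (at 0)"
    by (rule tendsto_at_0_if_DERIV_near, rule eventually_nhds_x_imp_x)
  have V: "((\<lambda>t. V (\<sigma> t) / t ^ 3) \<longlongrightarrow> - b 3 / 6) (at 0)"
  proof (rule Lim_transform_eventually)
    show "((\<lambda>t. - (\<gamma> t $ 3 / t ^ 3)) \<longlongrightarrow> - b 3 / 6) (at 0)"
      using tendsto_minus [OF lead(3)] by simp
    show "\<forall>\<^sub>F t in at 0. - (\<gamma> t $ 3 / t ^ 3) = V (\<sigma> t) / t ^ 3"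
      using uv by eventually_elim (metis minus_divide_left)
  qed
  have "((\<lambda>t. V (\<sigma> t) / t ^ 2) \<longlongrightarrow> 0) (at 0)"
    using V by (rule tendsto_div_power_lower) simp
  moreover have "((\<lambda>t. V (\<sigma> t) / t ^ 2) \<longlongrightarrow> \<kappa> 0 / 2 * sin \<theta> ^ 2) (at 0)"
    using frenet_germ_leading_terms(2) [OF fr \<kappa>lim] \<sigma> \<theta> by (intro tendsto_div_power_compose) simp_all
  ultimately have "\<kappa> 0 / 2 * sin \<theta> ^ 2 = 0"
    using tendsto_unique [OF trivial_limit_at] by blast
  with \<theta> have \<kappa>0: "\<kappa> 0 = 0" by simp
  have \<kappa>1: "((\<lambda>s. \<kappa> s / s) \<longlongrightarrow> deriv \<kappa> 0) (at 0)"
    using d\<kappa> has_real_derivative_at_0_iff_quotient [of \<kappa>, OF \<kappa>0] by simp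
  have "((\<lambda>t. V (\<sigma> t) / t ^ 3) \<longlongrightarrow> deriv \<kappa> 0 / 6 * sin \<theta> ^ 3) (at 0)"
    using frenet_germ_leading_terms(4) [OF fr \<kappa>lim \<kappa>1] \<sigma> \<theta> by (intro tendsto_div_power_compose) simp_all
  with V have "- b 3 / 6 = deriv \<kappa> 0 / 6 * sin \<theta> ^ 3"
    using tendsto_unique [OF trivial_limit_at] by blast
  with \<theta> have "deriv \<kappa> 0 = - b 3 / sin \<theta> ^ 3" by (simp add: field_simps)
  with fr \<sigma> uv sm \<kappa>lim \<kappa>0 \<kappa>1 show ?thesis by (intro that) simp_all
qed

text \<open>
  Two arc-length curves with nearly equal curvatures differ, at the points \<open>\<sigma> t\<close> and \<open>\<sigma>' t\<close>, essentially
  by the shift \<open>\<sigma> t - \<sigma>' t\<close> along one of them.  The first coordinate shows the size of this shift, and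
  the second one responds to it with the factor \<open>Q \<approx> c s^2 / 2\<close>.
\<close>

lemma frenet_germ_coordinate_comparison:
  assumes fr: "frenet_germ \<kappa> U V P Q" and fr': "frenet_germ \<kappa>' U' V' P' Q'"
    and \<sigma>: "((\<lambda>t. \<sigma> t / t) \<longlongrightarrow> r) (at 0)" and \<sigma>': "((\<lambda>t. \<sigma>' t / t) \<longlongrightarrow> r) (at 0)" and r: "r \<noteq> 0"
    and \<kappa>: "(\<kappa> \<longlongrightarrow> 0) (at 0)" "((\<lambda>s. \<kappa> s / s) \<longlongrightarrow> c) (at 0)"
    and m: "((\<lambda>s. (\<kappa> s - \<kappa>' s) / s ^ m) \<longlongrightarrow> 0) (at 0)"
    and \<alpha>: "((\<lambda>t. (U (\<sigma> t) - U' (\<sigma>' t)) / t ^ m) \<longlongrightarrow> \<alpha>) (at 0)"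
    and \<beta>: "((\<lambda>t. (V (\<sigma> t) - V' (\<sigma>' t)) / t ^ (m + 2)) \<longlongrightarrow> \<beta>) (at 0)"
  shows "\<beta> = c / 2 * r ^ 2 * \<alpha>"
proof -
  have "((\<lambda>s. P s / s ^ 0) \<longlongrightarrow> 1) (at 0)"
    using frenet_germ_leading_terms(1) [OF fr \<kappa>(1)] by simp
  from increment_asymptotics [OF frenet_germD(5) [OF fr] this \<sigma> \<sigma>' r] obtain p
    where p: "\<forall>\<^sub>F t in at 0. U (\<sigma> t) - U (\<sigma>' t) = p t * (\<sigma> t - \<sigma>' t)"
      and p1: "((\<lambda>t. p t / t ^ 0) \<longlongrightarrow> 1 * r ^ 0) (at 0)" .
  from increment_asymptotics [OF frenet_germD(6) [OF fr] frenet_germ_leading_terms(3) [OF fr \<kappa>] \<sigma> \<sigma>' r]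
  obtain q where q: "\<forall>\<^sub>F t in at 0. V (\<sigma> t) - V (\<sigma>' t) = q t * (\<sigma> t - \<sigma>' t)"
      and q2: "((\<lambda>t. q t / t ^ 2) \<longlongrightarrow> c / 2 * r ^ 2) (at 0)" .
  note cmp = frenet_germ_comparison [OF fr fr' \<kappa>(1) m]
  have dU: "((\<lambda>t. (U (\<sigma>' t) - U' (\<sigma>' t)) / t ^ (m + 2)) \<longlongrightarrow> 0) (at 0)"
    using tendsto_div_power_compose [OF cmp(1) \<sigma>' r] by simp
  have dV: "((\<lambda>t. (V (\<sigma>' t) - V' (\<sigma>' t)) / t ^ (m + 2)) \<longlongrightarrow> 0) (at 0)"
    using tendsto_div_power_compose [OF cmp(2) \<sigma>' r] by simp
  have dU': "((\<lambda>t. (U (\<sigma>' t) - U' (\<sigma>' t)) / t ^ m) \<longlongrightarrow> 0) (at 0)"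
    using dU by (rule tendsto_div_power_lower) simp
  \<comment> \<open>Solve \<open>U \<circ> \<sigma> - U' \<circ> \<sigma>' = p (\<sigma> - \<sigma>') + (U - U') \<circ> \<sigma>'\<close> for the shift \<open>\<sigma> - \<sigma>'\<close>.\<close>
  have p1': "(p \<longlongrightarrow> 1) (at 0)" using p1 by simp
  have "((\<lambda>t. ((U (\<sigma> t) - U' (\<sigma>' t)) / t ^ m - (U (\<sigma>' t) - U' (\<sigma>' t)) / t ^ m) / p t)
      \<longlongrightarrow> (\<alpha> - 0) / 1) (at 0)"
    by (intro tendsto_intros \<alpha> dU' p1') simp
  moreover have "\<forall>\<^sub>F t in at 0. p t \<noteq> 0"
    using p1' by (rule tendsto_imp_eventually_ne) simp
  then have "\<forall>\<^sub>F t in at 0. ((U (\<sigma> t) - U' (\<sigma>' t)) / t ^ m - (U (\<sigma>' t) - U' (\<sigma>' t)) / t ^ m) / p t =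
      (\<sigma> t - \<sigma>' t) / t ^ m"
    using p
  proof eventually_elim
    case (elim t)
    have "(U (\<sigma> t) - U' (\<sigma>' t)) / t ^ m - (U (\<sigma>' t) - U' (\<sigma>' t)) / t ^ m = (U (\<sigma> t) - U (\<sigma>' t)) / t ^ m"
      by (simp flip: diff_divide_distrib)
    with elim show ?case by simp
  qed
  ultimately have d: "((\<lambda>t. (\<sigma> t - \<sigma>' t) / t ^ m) \<longlongrightarrow> \<alpha>) (at 0)"
    by (simp add: tendsto_cong)
  have "((\<lambda>t. q t / t ^ 2 * ((\<sigma> t - \<sigma>' t) / t ^ m) + (V (\<sigma>' t) - V' (\<sigma>' t)) / t ^ (m + 2)) \<longlongrightarrow>
      c / 2 * r ^ 2 * \<alpha> + 0) (at 0)"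
    by (intro tendsto_intros q2 d dV)
  moreover have "\<forall>\<^sub>F t in at 0. q t / t ^ 2 * ((\<sigma> t - \<sigma>' t) / t ^ m) + (V (\<sigma>' t) - V' (\<sigma>' t)) / t ^ (m + 2)
      = (V (\<sigma> t) - V' (\<sigma>' t)) / t ^ (m + 2)"
    using q
  proof eventually_elim
    case (elim t)
    have "q t / t ^ 2 * ((\<sigma> t - \<sigma>' t) / t ^ m) = (V (\<sigma> t) - V (\<sigma>' t)) / t ^ (m + 2)"
      unfolding elim by (simp add: power_add power2_eq_square mult_ac)
    then show ?case by (simp flip: add_divide_distrib)
  qed
  ultimately have "((\<lambda>t. (V (\<sigma> t) - V' (\<sigma>' t)) / t ^ (m + 2)) \<longlongrightarrow> c / 2 * r ^ 2 * \<alpha>) (at 0)"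
    by (simp add: tendsto_cong)
  then show ?thesis
    using \<beta> tendsto_unique [OF trivial_limit_at] by blast
qed

text \<open>
  The one linear equation that a single projection imposes on the first coefficients in which two
  curves with the same curvature jet can differ.  Its ratio of coefficients is \<open>cot \<theta>\<close> up to a factor
  independent of \<open>\<theta>\<close>, which is why a second direction is needed, and suffices, to separate the two
  unknowns.
\<close>

lemma projected_coefficient_constraint:
  fixes \<gamma> \<gamma>' :: "real \<Rightarrow> real^3" and I I' :: "real set" and \<theta> :: real
  defines "\<kappa> \<equiv> curvature_of_arc_length I \<gamma> \<theta>" and "\<kappa>' \<equiv> curvature_of_arc_length I' \<gamma>' \<theta>"
  assumes \<gamma>: "regular_smooth_curve I \<gamma>" "\<gamma> 0 = 0" and nf: "normal_form k \<gamma> a b"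
    and \<gamma>': "regular_smooth_curve I' \<gamma>'" "\<gamma>' 0 = 0" and nf': "normal_form k \<gamma>' a' b'"
    and m: "2 \<le> m" "m + 2 \<le> k" and \<theta>: "0 < sin \<theta>"
    and jets: "\<And>i. i \<le> m \<Longrightarrow> (deriv ^^ i) \<kappa> 0 = (deriv ^^ i) \<kappa>' 0"
    and a: "\<And>i. 2 \<le> i \<Longrightarrow> i < m \<Longrightarrow> a i = a' i" and b: "\<And>i. 3 \<le> i \<Longrightarrow> i < m + 2 \<Longrightarrow> b i = b' i"
  shows "2 * sin \<theta> * ((b (m + 2) - b' (m + 2)) / fact (m + 2)) =
    - b 3 * cos \<theta> * ((a m - a' m) / fact m)"
proof -
  let ?A = "(a m - a' m) / fact m" and ?B = "(b (m + 2) - b' (m + 2)) / fact (m + 2)"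
  have k: "3 \<le> k" using m by simp
  obtain U V P Q \<sigma> where fr: "frenet_germ \<kappa> U V P Q"
    and \<sigma>: "((\<lambda>t. \<sigma> t / t) \<longlongrightarrow> sin \<theta>) (at 0)"
    and uv: "\<forall>\<^sub>F t in at 0. sin \<theta> * \<gamma> t $ 1 - cos \<theta> * \<gamma> t $ 2 = U (\<sigma> t) \<and> - \<gamma> t $ 3 = V (\<sigma> t)"
    and sm: "\<forall>i. \<forall>\<^sub>F s in nhds 0. ((deriv ^^ i) \<kappa> has_real_derivative (deriv ^^ Suc i) \<kappa> s) (at s)"
    and \<kappa>0: "(\<kappa> \<longlongrightarrow> 0) (at 0)" and \<kappa>1: "((\<lambda>s. \<kappa> s / s) \<longlongrightarrow> - b 3 / sin \<theta> ^ 3) (at 0)"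
    and "deriv \<kappa> 0 = - b 3 / sin \<theta> ^ 3"
    by (rule projected_frame_in_normal_form [OF \<gamma> nf k \<theta>, folded \<kappa>_def])
  obtain U' V' P' Q' \<sigma>' where fr': "frenet_germ \<kappa>' U' V' P' Q'"
    and \<sigma>': "((\<lambda>t. \<sigma>' t / t) \<longlongrightarrow> sin \<theta>) (at 0)"
    and uv': "\<forall>\<^sub>F t in at 0. sin \<theta> * \<gamma>' t $ 1 - cos \<theta> * \<gamma>' t $ 2 = U' (\<sigma>' t) \<and> - \<gamma>' t $ 3 = V' (\<sigma>' t)"
    and sm': "\<forall>i. \<forall>\<^sub>F s in nhds 0. ((deriv ^^ i) \<kappa>' has_real_derivative (deriv ^^ Suc i) \<kappa>' s) (at s)"
    and "(\<kappa>' \<longlongrightarrow> 0) (at 0)" and "((\<lambda>s. \<kappa>' s / s) \<longlongrightarrow> - b' 3 / sin \<theta> ^ 3) (at 0)"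
    and "deriv \<kappa>' 0 = - b' 3 / sin \<theta> ^ 3"
    by (rule projected_frame_in_normal_form [OF \<gamma>' nf' k \<theta>, folded \<kappa>'_def])
  define H where "H i s = (deriv ^^ i) \<kappa> s - (deriv ^^ i) \<kappa>' s" for i s
  have "((\<lambda>s. H 0 s / s ^ m) \<longlongrightarrow> 0) (at 0)"
  proof (rule tendsto_div_power_of_vanishing_derivatives)
    show "\<forall>\<^sub>F s in nhds 0. (H i has_real_derivative H (Suc i) s) (at s)" for i
      using sm [rule_format, of i] sm' [rule_format, of i] unfolding H_def [abs_def] by eventually_elim (rule DERIV_diff)
    show "H i 0 = 0" if "i \<le> m" for i using jets [OF that] by (simp add: H_def)
  qed
  then have \<kappa>m: "((\<lambda>s. (\<kappa> s - \<kappa>' s) / s ^ m) \<longlongrightarrow> 0) (at 0)"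
    by (simp add: H_def)
  note lim = normal_form_difference_limits [OF nf nf']
  have x: "((\<lambda>t. (\<gamma> t $ 1 - \<gamma>' t $ 1) / t ^ m) \<longlongrightarrow> 0) (at 0)"
    using lim(1) [of m] m by simp
  have y: "((\<lambda>t. (\<gamma> t $ 2 - \<gamma>' t $ 2) / t ^ m) \<longlongrightarrow> ?A) (at 0)"
    using m by (intro lim(2) a) simp_all
  have z: "((\<lambda>t. (\<gamma> t $ 3 - \<gamma>' t $ 3) / t ^ (m + 2)) \<longlongrightarrow> ?B) (at 0)"
    using m by (intro lim(3) b) simp_all
  have \<alpha>: "((\<lambda>t. (U (\<sigma> t) - U' (\<sigma>' t)) / t ^ m) \<longlongrightarrow> - cos \<theta> * ?A) (at 0)"
  proof (rule Lim_transform_eventually)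
    show "((\<lambda>t. sin \<theta> * ((\<gamma> t $ 1 - \<gamma>' t $ 1) / t ^ m) - cos \<theta> * ((\<gamma> t $ 2 - \<gamma>' t $ 2) / t ^ m))
        \<longlongrightarrow> - cos \<theta> * ?A) (at 0)"
      using tendsto_diff [OF tendsto_mult_left [OF x, of "sin \<theta>"] tendsto_mult_left [OF y, of "cos \<theta>"]]
      by simp
    show "\<forall>\<^sub>F t in at 0. sin \<theta> * ((\<gamma> t $ 1 - \<gamma>' t $ 1) / t ^ m) - cos \<theta> * ((\<gamma> t $ 2 - \<gamma>' t $ 2) / t ^ m)
        = (U (\<sigma> t) - U' (\<sigma>' t)) / t ^ m"
      using uv uv'
    proof eventually_elim
      case (elim t)
      have "U (\<sigma> t) - U' (\<sigma>' t) =
          sin \<theta> * (\<gamma> t $ 1 - \<gamma>' t $ 1) - cos \<theta> * (\<gamma> t $ 2 - \<gamma>' t $ 2)"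
        unfolding conjunct1 [OF elim(1), symmetric] conjunct1 [OF elim(2), symmetric]
        by (simp add: algebra_simps)
      then show ?case
        by (simp only: times_divide_eq_right diff_divide_distrib [symmetric])
    qed
  qed
  have \<beta>: "((\<lambda>t. (V (\<sigma> t) - V' (\<sigma>' t)) / t ^ (m + 2)) \<longlongrightarrow> - ?B) (at 0)"
  proof (rule Lim_transform_eventually)
    show "((\<lambda>t. - ((\<gamma> t $ 3 - \<gamma>' t $ 3) / t ^ (m + 2))) \<longlongrightarrow> - ?B) (at 0)"
      using z by (rule tendsto_minus)
    show "\<forall>\<^sub>F t in at 0. - ((\<gamma> t $ 3 - \<gamma>' t $ 3) / t ^ (m + 2)) = (V (\<sigma> t) - V' (\<sigma>' t)) / t ^ (m + 2)"
      using uv uv'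
    proof eventually_elim
      case (elim t)
      have "V (\<sigma> t) - V' (\<sigma>' t) = - (\<gamma> t $ 3 - \<gamma>' t $ 3)"
        unfolding conjunct2 [OF elim(1), symmetric] conjunct2 [OF elim(2), symmetric] by simp
      then show ?case by (simp only: minus_divide_left)
    qed
  qed
  have "- ?B = - b 3 / sin \<theta> ^ 3 / 2 * sin \<theta> ^ 2 * (- cos \<theta> * ?A)"
    using \<theta> by (intro frenet_germ_coordinate_comparison [OF fr fr' \<sigma> \<sigma>' _ \<kappa>0 \<kappa>1 \<kappa>m \<alpha> \<beta>]) simp
  moreover have "2 * s * B = - c * x * A"
    if "- B = - c / s ^ 3 / 2 * s ^ 2 * (- x * A)" "0 < s" for s B c x A :: real
  proof -
    have "- c / s ^ 3 / 2 * s ^ 2 = - c / (2 * s)"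
      using \<open>0 < s\<close> by (simp add: power3_eq_cube power2_eq_square)
    then have "- B = - c / (2 * s) * (- x * A)"
      using that(1) by (simp only:)
    then have "B = - (c * x * A) / (2 * s)" by simp
    then show ?thesis using \<open>0 < s\<close> by simp
  qed
  ultimately show ?thesis using \<theta> by blast
qed

section \<open>Reconstruction of angles and coefficients\<close>

lemma sin_difference_nonzero:
  fixes x y :: real
  assumes "x \<in> {0<..<pi}" "y \<in> {0<..<pi}" "x \<noteq> y"
  shows "sin (x - y) \<noteq> 0"
proof (cases "x < y")
  case True
  then have "0 < sin (y - x)" using assms by (intro sin_gt_zero) auto
  then show ?thesis using sin_minus [of "y - x"] by simp
next
  case False
  then have "0 < sin (x - y)" using assms by (intro sin_gt_zero) auto
  then show ?thesis by simp
qed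

text \<open>
  With \<open>\<alpha> = \<phi> + \<beta>\<close> and \<open>\<alpha>' = \<phi> + \<beta>'\<close> the cross difference of the sines factors as
  \<open>sin \<phi> sin (\<beta>' - \<beta>)\<close>, and sines of differences of angles from \<open>(0, \<pi>)\<close> vanish only for equal angles.
\<close>

lemma angles_determined_by_sine_ratio:
  fixes \<alpha> \<beta> \<alpha>' \<beta>' :: real
  assumes "{\<alpha>, \<beta>, \<alpha>', \<beta>'} \<subseteq> {0<..<pi}" "\<alpha> \<noteq> \<beta>" and diff: "\<alpha> - \<beta> = \<alpha>' - \<beta>'"
    and ratio: "sin \<alpha> * sin \<beta>' = sin \<alpha>' * sin \<beta>"
  shows "\<alpha> = \<alpha>' \<and> \<beta> = \<beta>'"
proof -
  have eq: "\<alpha> = (\<alpha> - \<beta>) + \<beta>" "\<alpha>' = (\<alpha> - \<beta>) + \<beta>'" using diff by auto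
  have "sin \<alpha> * sin \<beta>' - sin \<alpha>' * sin \<beta> = sin (\<alpha> - \<beta>) * sin (\<beta>' - \<beta>)"
    by (subst (1) eq(1), subst (1) eq(2), subst sin_add, subst sin_add, subst (2) sin_diff)
       (simp add: algebra_simps)
  with ratio have "sin (\<alpha> - \<beta>) = 0 \<or> sin (\<beta>' - \<beta>) = 0" by simp
  moreover have "sin (\<alpha> - \<beta>) \<noteq> 0"
    using assms(1,2) by (intro sin_difference_nonzero) auto
  ultimately have "\<beta>' = \<beta>"
    using assms(1) sin_difference_nonzero [of \<beta>' \<beta>] by auto
  then show ?thesis using diff by simp
qed

lemma order_info_eqD:
  assumes "order_info n f = order_info n g" "i \<le> n"
  shows "(deriv ^^ i) f 0 = (deriv ^^ i) g 0"
proof -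
  have "\<forall>i\<in>set [0..<Suc n]. (deriv ^^ i) f 0 / fact i = (deriv ^^ i) g 0 / fact i"
    using assms(1) unfolding order_info_def map_eq_conv .
  from bspec [OF this, of i] show ?thesis using assms(2) by (simp add: le_imp_less_Suc del: upt_Suc)
qed

lemma order_info_mono:
  assumes "order_info n f = order_info n g" "m \<le> n"
  shows "order_info m f = order_info m g"
  unfolding order_info_def map_eq_conv
proof
  fix i assume "i \<in> set [0..<Suc m]"
  then have "i \<le> n" using assms(2) by (simp del: upt_Suc)
  from order_info_eqD [OF assms(1) this]
  show "(deriv ^^ i) f 0 / fact i = (deriv ^^ i) g 0 / fact i" by simp
qed

lemma configuration_sin_pos:
  "C \<in> configurations k \<Longrightarrow> 0 < sin (theta1 C) \<and> 0 < sin (theta2 C)"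
  by (auto simp: configurations_def intro: sin_gt_zero)

lemma configuration_curvature_derivatives:
  assumes C: "C \<in> configurations k" and k: "3 \<le> k"
  shows "deriv (kappa1 C) 0 = - coeff_b C 3 / sin (theta1 C) ^ 3"
    and "deriv (kappa2 C) 0 = - coeff_b C 3 / sin (theta2 C) ^ 3"
    and "coeff_b C 3 \<noteq> 0"
proof -
  have reg: "regular_smooth_curve (dom_of C) (curve C)" "curve C 0 = 0"
    and nf: "normal_form k (curve C) (coeff_a C) (coeff_b C)"
    and ne: "(deriv (kappa1 C) 0, deriv (kappa2 C) 0) \<noteq> (0, 0)"
    using C by (simp_all add: configurations_def)
  note frame = projected_frame_in_normal_form [OF reg nf k]
  show 1: "deriv (kappa1 C) 0 = - coeff_b C 3 / sin (theta1 C) ^ 3"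
    unfolding kappa1_def by (rule frame [of "theta1 C"]) (use configuration_sin_pos [OF C] in auto)
  show 2: "deriv (kappa2 C) 0 = - coeff_b C 3 / sin (theta2 C) ^ 3"
    unfolding kappa2_def by (rule frame [of "theta2 C"]) (use configuration_sin_pos [OF C] in auto)
  show "coeff_b C 3 \<noteq> 0" using ne by (auto simp: 1 2)
qed

text \<open>
  The derivatives of the curvatures are \<open>- b\<^sub>3 / sin\<^sup>3 \<theta>\<close>, so eliminating \<open>b\<^sub>3 \<noteq> 0\<close> leaves the equality
  of the ratios of the sines.
\<close>

lemma angles_and_torsion_coefficient_determined:
  assumes C: "C \<in> configurations k" and C': "C' \<in> configurations k" and k: "3 \<le> k"
    and d1: "deriv (kappa1 C) 0 = deriv (kappa1 C') 0" and d2: "deriv (kappa2 C) 0 = deriv (kappa2 C') 0"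
    and diff: "theta1 C - theta2 C = theta1 C' - theta2 C'"
  shows "theta1 C = theta1 C' \<and> theta2 C = theta2 C' \<and> coeff_b C 3 = coeff_b C' 3"
proof -
  let ?s1 = "sin (theta1 C)" and ?s2 = "sin (theta2 C)"
    and ?s1' = "sin (theta1 C')" and ?s2' = "sin (theta2 C')"
    and ?b = "coeff_b C 3" and ?b' = "coeff_b C' 3"
  have pos: "0 < ?s1" "0 < ?s2" "0 < ?s1'" "0 < ?s2'"
    using configuration_sin_pos [OF C] configuration_sin_pos [OF C'] by auto
  note D = configuration_curvature_derivatives [OF C k]
  note D' = configuration_curvature_derivatives [OF C' k]
  have e1: "?b * ?s1' ^ 3 = ?b' * ?s1 ^ 3" and e2: "?b * ?s2' ^ 3 = ?b' * ?s2 ^ 3"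
    using d1 d2 pos unfolding D(1,2) D'(1,2) by (simp_all add: field_simps)
  have "?b * ?b' * (?s1 * ?s2') ^ 3 = (?b' * ?s1 ^ 3) * (?b * ?s2' ^ 3)"
    by (simp add: power_mult_distrib)
  also have "\<dots> = (?b * ?s1' ^ 3) * (?b' * ?s2 ^ 3)" by (simp only: e1 e2)
  also have "\<dots> = ?b * ?b' * (?s1' * ?s2) ^ 3" by (simp add: power_mult_distrib)
  finally have "(?s1 * ?s2') ^ 3 = (?s1' * ?s2) ^ 3" using D(3) D'(3) by simp
  then have "?s1 * ?s2' = ?s1' * ?s2"
    using pos by (metis less_imp_le mult_nonneg_nonneg power_eq_imp_eq_base zero_less_numeral)
  moreover have "{theta1 C, theta2 C, theta1 C', theta2 C'} \<subseteq> {0<..<pi}" "theta1 C \<noteq> theta2 C"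
    using C C' by (auto simp: configurations_def)
  ultimately have "theta1 C = theta1 C' \<and> theta2 C = theta2 C'"
    using diff by (intro angles_determined_by_sine_ratio)
  then show ?thesis using e1 pos by simp
qed

lemma coefficients_determined:
  assumes C: "C \<in> configurations k" and C': "C' \<in> configurations k"
    and n: "4 \<le> n" "n \<le> k"
    and info: "order_info (n - 1) (kappa1 C) = order_info (n - 1) (kappa1 C')"
      "order_info (n - 1) (kappa2 C) = order_info (n - 1) (kappa2 C')"
    and diff: "theta1 C - theta2 C = theta1 C' - theta2 C'"
  shows "coeff_a C (n - 2) = coeff_a C' (n - 2) \<and> coeff_b C n = coeff_b C' n"
  using n info
proof (induction n rule: less_induct)
  case (less n)
  define m where "m = n - 2"
  have m: "2 \<le> m" "m + 2 \<le> k" "n = m + 2" "m \<le> n - 1" using less.prems by (auto simp: m_def)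
  have lower: "coeff_a C (i - 2) = coeff_a C' (i - 2) \<and> coeff_b C i = coeff_b C' i" if "4 \<le> i" "i < n" for i
    using that less.prems by (intro less.IH order_info_mono [of "n - 1" _ _ "i - 1"]) auto
  have jets: "(deriv ^^ i) (kappa1 C) 0 = (deriv ^^ i) (kappa1 C') 0"
    "(deriv ^^ i) (kappa2 C) 0 = (deriv ^^ i) (kappa2 C') 0" if "i \<le> m" for i
    using order_info_eqD [OF less.prems(3), of i] order_info_eqD [OF less.prems(4), of i] that m by auto
  have base: "theta1 C = theta1 C'" "theta2 C = theta2 C'" "coeff_b C 3 = coeff_b C' 3"
    using angles_and_torsion_coefficient_determined [OF C C' _ _ _ diff] jets [of 1] m by auto
  have a: "coeff_a C i = coeff_a C' i" if "2 \<le> i" "i < m" for i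
    using lower [of "i + 2"] that m by simp
  have b: "coeff_b C i = coeff_b C' i" if "3 \<le> i" "i < m + 2" for i
    using lower [of i] base(3) that m by (cases "i = 3") auto
  have reg: "regular_smooth_curve (dom_of C) (curve C)" "curve C 0 = 0"
      "normal_form k (curve C) (coeff_a C) (coeff_b C)"
    and reg': "regular_smooth_curve (dom_of C') (curve C')" "curve C' 0 = 0"
      "normal_form k (curve C') (coeff_a C') (coeff_b C')"
    and \<theta>: "theta1 C \<in> {0<..<pi}" "theta2 C \<in> {0<..<pi}" "theta1 C \<noteq> theta2 C"
    using C C' by (simp_all add: configurations_def)
  have s: "0 < sin (theta1 C)" "0 < sin (theta2 C)" using configuration_sin_pos [OF C] by auto
  let ?A = "(coeff_a C m - coeff_a C' m) / fact m"
    and ?B = "(coeff_b C (m + 2) - coeff_b C' (m + 2)) / fact (m + 2)"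
  \<comment> \<open>Two equations in \<open>?A\<close> and \<open>?B\<close> with determinant proportional to \<open>coeff_b C 3 * sin (theta1 C - theta2 C)\<close>.\<close>
  have 1: "2 * sin (theta1 C) * ?B = - coeff_b C 3 * cos (theta1 C) * ?A"
    by (rule projected_coefficient_constraint [OF reg reg' m(1,2) s(1)
          jets(1) [unfolded kappa1_def base(1) [symmetric]] a b])
  have 2: "2 * sin (theta2 C) * ?B = - coeff_b C 3 * cos (theta2 C) * ?A"
    by (rule projected_coefficient_constraint [OF reg reg' m(1,2) s(2)
          jets(2) [unfolded kappa2_def base(2) [symmetric]] a b])
  have "coeff_b C 3 * ?A * sin (theta1 C - theta2 C) =
      sin (theta1 C) * (coeff_b C 3 * cos (theta2 C) * ?A) - sin (theta2 C) * (coeff_b C 3 * cos (theta1 C) * ?A)"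
    unfolding sin_diff right_diff_distrib by (simp only: mult_ac)
  also have "\<dots> = sin (theta2 C) * (2 * sin (theta1 C) * ?B) - sin (theta1 C) * (2 * sin (theta2 C) * ?B)"
    unfolding 1 2 by simp
  finally have "coeff_b C 3 * ?A * sin (theta1 C - theta2 C) = 0" by simp
  moreover have "sin (theta1 C - theta2 C) \<noteq> 0"
    using \<theta> by (intro sin_difference_nonzero) auto
  moreover have "coeff_b C 3 \<noteq> 0"
    using configuration_curvature_derivatives(3) [OF C] m by simp
  ultimately have A: "?A = 0" by simp
  with 1 s have "?B = 0" by simp
  with A m(3) show ?case by simp
qed

theorem theorem2p1:
  "(\<forall>k\<ge>3. uniquely_determined (configurations k)
             (\<lambda>C. (theta1 C, theta2 C, coeff_b C 3))
             (curvature_data 2)) \<and>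
   (\<forall>n\<ge>4. \<forall>k\<ge>n. uniquely_determined (configurations k)
             (\<lambda>C. (coeff_a C (n - 2), coeff_b C n))
             (curvature_data (n - 1)))"
proof (intro conjI allI impI)
  fix k :: nat assume k: "3 \<le> k"
  show "uniquely_determined (configurations k)
     (\<lambda>C. (theta1 C, theta2 C, coeff_b C 3)) (curvature_data 2)"
    unfolding uniquely_determined_def
  proof (intro ballI impI)
    fix C C' assume C: "C \<in> configurations k" "C' \<in> configurations k"
      and eq: "curvature_data 2 C = curvature_data 2 C'"
    have "deriv (kappa1 C) 0 = deriv (kappa1 C') 0" "deriv (kappa2 C) 0 = deriv (kappa2 C') 0"
      using eq order_info_eqD [of 2 "kappa1 C" "kappa1 C'" 1] order_info_eqD [of 2 "kappa2 C" "kappa2 C'" 1]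
      by (simp_all add: curvature_data_def)
    with angles_and_torsion_coefficient_determined [OF C k] eq
    show "(theta1 C, theta2 C, coeff_b C 3) = (theta1 C', theta2 C', coeff_b C' 3)"
      by (simp add: curvature_data_def)
  qed
next
  fix n k :: nat assume n: "4 \<le> n" "n \<le> k"
  show "uniquely_determined (configurations k)
     (\<lambda>C. (coeff_a C (n - 2), coeff_b C n)) (curvature_data (n - 1))"
    unfolding uniquely_determined_def
  proof (intro ballI impI)
    fix C C' assume C: "C \<in> configurations k" "C' \<in> configurations k"
      and eq: "curvature_data (n - 1) C = curvature_data (n - 1) C'"
    with coefficients_determined [OF C n]
    show "(coeff_a C (n - 2), coeff_b C n) = (coeff_a C' (n - 2), coeff_b C' n)"
      by (simp add: curvature_data_def)
  qed
qed

end
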